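(* Let $(\lambda,\mu)\in\mathcal{O}_1$ and let $(w_{\lambda,\mu},z_{\lambda,\mu})$ be the minimal solution of (E). Let $\lambda_1>0$ be the first eigenvalue of $-\Delta$ in $H_0^1(\Omega)$ and $\phi$ the corresponding (positive) eigenfunction with $\int_\Omega\phi\,dx=1$. (1) There hold $$\int_\Omega w_{\lambda,\mu}\phi\,dx\le\frac{\lambda_1\int_\Omega\frac{\phi}{\alpha}\,dx}{\lambda f(0)}\quad\text{and}\quad\int_\Omega z_{\lambda,\mu}\phi\,dx\le\frac{\lambda_1\int_\Omega\frac{\phi}{\beta}\,dx}{\mu g(0)}.$$ (2) If (E) has another solution $(w_1,z_1)$, then there further hold $$\int_\Omega w_1\phi\,dx\le\frac{\lambda_1\int_\Omega\frac{\phi}{\alpha}\,dx}{\lambda f(0)}\quad\text{and}\quad\int_\Omega z_1\phi\,dx\le\frac{\lambda_1\int_\Omega\frac{\phi}{\beta}\,dx}{\mu g(0)}.$$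
   Context: $\Omega\subset\mathbb{R}^N$ is a smooth bounded domain; $\lambda,\mu>0$; $\alpha,\beta$ are nonnegative, nontrivial (not identically zero), Hölder continuous functions on $\bar\Omega$; $f,g\in C^2[0,1)$ are positive, increasing and strictly convex with $\lim_{v\to1^-}f(v)=\lim_{u\to1^-}g(u)=+\infty$. Problem (E) is $$-\Delta w=\lambda\alpha(x)f(z),\quad -\Delta z=\mu\beta(x)g(w)\ \text{ in }\Omega,\qquad w=z=0\ \text{ on }\partial\Omega.$$ Solutions of (E) are classical, with $0\le w,z<1$; the minimal solution is the solution which is $\le$ (componentwise) every other solution. Let $\Lambda$ be the set of $(\lambda,\mu)\in\mathbb{R}^+\times\mathbb{R}^+$ for which (E) has a classical minimal solution. The critical curve $\mu=\Gamma(\lambda)$ is the non-increasing continuous curve, connecting $(0,\mu^* )$ to $(\lambda^*,0)$ for some $0<\lambda^*,\mu^*<\infty$, such that $(\lambda,\mu)\in\Lambda$ if $\mu<\Gamma(\lambda)$ and $(\lambda,\mu)\in(\mathbb{R}^+\times\mathbb{R}^+)\setminus\bar\Lambda$ if $\mu>\Gamma(\lambda)$; put $\mathcal{O}_1=\Lambda\setminus\Gamma$. The integrals of $\phi/\alpha$ and $\phi/\beta$ take values in $(0,+\infty]$; an inequality with right-hand side $+\infty$ is trivially true. *)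

theory Defs
  imports "HOL-Analysis.Analysis"
begin

section \<open>Smooth functions and smooth domains\<close>

text \<open>The ambient space R^N is an arbitrary Euclidean space \<open>'a\<close>, with N = DIM('a).\<close>

text \<open>Meant for open sets only, since the derivatives are two-sided.\<close>
primrec Ck_on :: "nat \<Rightarrow> 'a::euclidean_space set \<Rightarrow> ('a \<Rightarrow> real) \<Rightarrow> bool" where
  "Ck_on 0 S u \<longleftrightarrow> continuous_on S u"
| "Ck_on (Suc k) S u \<longleftrightarrow> (\<forall>x\<in>S. u differentiable (at x)) \<and>
     (\<forall>b\<in>Basis. Ck_on k S (\<lambda>x. frechet_derivative u (at x) b))"

definition smooth_on :: "'a::euclidean_space set \<Rightarrow> ('a \<Rightarrow> real) \<Rightarrow> bool" where
  "smooth_on S u \<longleftrightarrow> (\<forall>k. Ck_on k S u)"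

definition grad :: "('a::euclidean_space \<Rightarrow> real) \<Rightarrow> 'a \<Rightarrow> 'a" where
  "grad u x = (\<Sum>b\<in>Basis. frechet_derivative u (at x) b *\<^sub>R b)"

definition laplacian :: "('a::euclidean_space \<Rightarrow> real) \<Rightarrow> 'a \<Rightarrow> real" where
  "laplacian u x =
     (\<Sum>b\<in>Basis. frechet_derivative (\<lambda>y. frechet_derivative u (at y) b) (at x) b)"

text \<open>Smoothness of the boundary is expressed by local defining functions \<open>\<rho>\<close>. As the gradient
  of \<open>\<rho>\<close> vanishes nowhere on U, the boundary inside U is exactly the zero set of \<open>\<rho>\<close>, and
  the domain lies locally on one side of it.\<close>
definition smooth_bounded_domain :: "'a::euclidean_space set \<Rightarrow> bool" where
  "smooth_bounded_domain \<Omega> \<longleftrightarrow>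
     open \<Omega> \<and> connected \<Omega> \<and> \<Omega> \<noteq> {} \<and> bounded \<Omega> \<and>
     (\<forall>p\<in>frontier \<Omega>. \<exists>U \<rho>. open U \<and> p \<in> U \<and> smooth_on U \<rho> \<and>
        (\<forall>x\<in>U. grad \<rho> x \<noteq> 0) \<and> \<Omega> \<inter> U = {x\<in>U. \<rho> x < 0})"

section \<open>The system (E)\<close>

definition hoelder_on :: "'a::metric_space set \<Rightarrow> ('a \<Rightarrow> real) \<Rightarrow> bool" where
  "hoelder_on S u \<longleftrightarrow>
     (\<exists>\<gamma> C. 0 < \<gamma> \<and> \<gamma> \<le> 1 \<and> (\<forall>x\<in>S. \<forall>y\<in>S. \<bar>u x - u y\<bar> \<le> C * dist x y powr \<gamma>))"

definition weight :: "'a::euclidean_space set \<Rightarrow> ('a \<Rightarrow> real) \<Rightarrow> bool" where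
  "weight \<Omega> \<alpha> \<longleftrightarrow> hoelder_on (closure \<Omega>) \<alpha> \<and>
     (\<forall>x\<in>closure \<Omega>. 0 \<le> \<alpha> x) \<and> (\<exists>x\<in>closure \<Omega>. \<alpha> x \<noteq> 0)"

text \<open>Derivatives on [0,1) are one-sided at 0.\<close>
definition C2_on_Ico :: "(real \<Rightarrow> real) \<Rightarrow> bool" where
  "C2_on_Ico f \<longleftrightarrow> (\<exists>f' f''.
     (\<forall>t\<in>{0..<1}. (f has_real_derivative f' t) (at t within {0..<1})) \<and>
     (\<forall>t\<in>{0..<1}. (f' has_real_derivative f'' t) (at t within {0..<1})) \<and>
     continuous_on {0..<1} f'')"

definition strictly_convex_on :: "real set \<Rightarrow> (real \<Rightarrow> real) \<Rightarrow> bool" where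
  "strictly_convex_on S f \<longleftrightarrow> (\<forall>x\<in>S. \<forall>y\<in>S. \<forall>t. x \<noteq> y \<and> 0 < t \<and> t < 1 \<longrightarrow>
     f ((1 - t) * x + t * y) < (1 - t) * f x + t * f y)"

text \<open>With strict convexity, monotonicity and strict monotonicity are the same requirement.\<close>
definition singular_nonlinearity :: "(real \<Rightarrow> real) \<Rightarrow> bool" where
  "singular_nonlinearity f \<longleftrightarrow> C2_on_Ico f \<and> (\<forall>t\<in>{0..<1}. 0 < f t) \<and>
     mono_on {0..<1} f \<and> strictly_convex_on {0..<1} f \<and> filterlim f at_top (at_left 1)"

definition solution ::
  "'a::euclidean_space set \<Rightarrow> ('a \<Rightarrow> real) \<Rightarrow> ('a \<Rightarrow> real) \<Rightarrow> (real \<Rightarrow> real) \<Rightarrow> (real \<Rightarrow> real) \<Rightarrow>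
   real \<Rightarrow> real \<Rightarrow> ('a \<Rightarrow> real) \<Rightarrow> ('a \<Rightarrow> real) \<Rightarrow> bool" where
  "solution \<Omega> \<alpha> \<beta> f g l m w z \<longleftrightarrow>
     Ck_on 2 \<Omega> w \<and> Ck_on 2 \<Omega> z \<and>
     continuous_on (closure \<Omega>) w \<and> continuous_on (closure \<Omega>) z \<and>
     (\<forall>x\<in>closure \<Omega>. 0 \<le> w x \<and> w x < 1 \<and> 0 \<le> z x \<and> z x < 1) \<and>
     (\<forall>x\<in>\<Omega>. - laplacian w x = l * \<alpha> x * f (z x)) \<and>
     (\<forall>x\<in>\<Omega>. - laplacian z x = m * \<beta> x * g (w x)) \<and>
     (\<forall>x\<in>frontier \<Omega>. w x = 0 \<and> z x = 0)"

definition minimal_solution ::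
  "'a::euclidean_space set \<Rightarrow> ('a \<Rightarrow> real) \<Rightarrow> ('a \<Rightarrow> real) \<Rightarrow> (real \<Rightarrow> real) \<Rightarrow> (real \<Rightarrow> real) \<Rightarrow>
   real \<Rightarrow> real \<Rightarrow> ('a \<Rightarrow> real) \<Rightarrow> ('a \<Rightarrow> real) \<Rightarrow> bool" where
  "minimal_solution \<Omega> \<alpha> \<beta> f g l m w z \<longleftrightarrow> solution \<Omega> \<alpha> \<beta> f g l m w z \<and>
     (\<forall>w' z'. solution \<Omega> \<alpha> \<beta> f g l m w' z' \<longrightarrow> (\<forall>x\<in>closure \<Omega>. w x \<le> w' x \<and> z x \<le> z' x))"

definition Lambda_set ::
  "'a::euclidean_space set \<Rightarrow> ('a \<Rightarrow> real) \<Rightarrow> ('a \<Rightarrow> real) \<Rightarrow> (real \<Rightarrow> real) \<Rightarrow> (real \<Rightarrow> real) \<Rightarrow>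
   (real \<times> real) set" where
  "Lambda_set \<Omega> \<alpha> \<beta> f g =
     {(l, m). 0 < l \<and> 0 < m \<and> (\<exists>w z. minimal_solution \<Omega> \<alpha> \<beta> f g l m w z)}"

text \<open>The curve lives over the interval [0,ls]; values of \<open>\<Gamma>\<close> elsewhere are irrelevant.\<close>
definition critical_curve ::
  "'a::euclidean_space set \<Rightarrow> ('a \<Rightarrow> real) \<Rightarrow> ('a \<Rightarrow> real) \<Rightarrow> (real \<Rightarrow> real) \<Rightarrow> (real \<Rightarrow> real) \<Rightarrow>
   real \<Rightarrow> real \<Rightarrow> (real \<Rightarrow> real) \<Rightarrow> bool" where
  "critical_curve \<Omega> \<alpha> \<beta> f g ls ms \<Gamma> \<longleftrightarrow>
     0 < ls \<and> 0 < ms \<and> \<Gamma> 0 = ms \<and> \<Gamma> ls = 0 \<and>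
     continuous_on {0..ls} \<Gamma> \<and> antimono_on {0..ls} \<Gamma> \<and>
     (\<forall>l m. 0 < l \<and> l \<le> ls \<and> 0 < m \<longrightarrow>
        (m < \<Gamma> l \<longrightarrow> (l, m) \<in> Lambda_set \<Omega> \<alpha> \<beta> f g) \<and>
        (\<Gamma> l < m \<longrightarrow> (l, m) \<notin> closure (Lambda_set \<Omega> \<alpha> \<beta> f g)))"

definition O1_set ::
  "'a::euclidean_space set \<Rightarrow> ('a \<Rightarrow> real) \<Rightarrow> ('a \<Rightarrow> real) \<Rightarrow> (real \<Rightarrow> real) \<Rightarrow> (real \<Rightarrow> real) \<Rightarrow>
   real \<Rightarrow> (real \<Rightarrow> real) \<Rightarrow> (real \<times> real) set" where
  "O1_set \<Omega> \<alpha> \<beta> f g ls \<Gamma> = Lambda_set \<Omega> \<alpha> \<beta> f g - {(l, \<Gamma> l) | l. l \<in> {0..ls}}"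

section \<open>Dirichlet eigenvalues in \<open>H\<^sub>0\<^sup>1\<close>\<close>

definition test_function :: "'a::euclidean_space set \<Rightarrow> ('a \<Rightarrow> real) \<Rightarrow> bool" where
  "test_function \<Omega> \<psi> \<longleftrightarrow> smooth_on UNIV \<psi> \<and>
     compact (closure {x. \<psi> x \<noteq> 0}) \<and> closure {x. \<psi> x \<noteq> 0} \<subseteq> \<Omega>"

definition L2_on :: "'a::euclidean_space set \<Rightarrow> ('a \<Rightarrow> 'b::euclidean_space) \<Rightarrow> bool" where
  "L2_on \<Omega> u \<longleftrightarrow> u \<in> borel_measurable (lebesgue_on \<Omega>) \<and>
     integrable (lebesgue_on \<Omega>) (\<lambda>x. (norm (u x))\<^sup>2)"

definition weak_gradient :: "'a::euclidean_space set \<Rightarrow> ('a \<Rightarrow> real) \<Rightarrow> ('a \<Rightarrow> 'a) \<Rightarrow> bool" where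
  "weak_gradient \<Omega> u G \<longleftrightarrow> (\<forall>\<psi>. test_function \<Omega> \<psi> \<longrightarrow>
     (LINT x|lebesgue_on \<Omega>. u x *\<^sub>R grad \<psi> x) = - (LINT x|lebesgue_on \<Omega>. \<psi> x *\<^sub>R G x))"

text \<open>\<open>H01 \<Omega> u G\<close>: u belongs to \<open>H\<^sub>0\<^sup>1\<close>, the closure of the test functions in \<open>H\<^sup>1\<close>, and has
  weak gradient G.\<close>
definition H01 :: "'a::euclidean_space set \<Rightarrow> ('a \<Rightarrow> real) \<Rightarrow> ('a \<Rightarrow> 'a) \<Rightarrow> bool" where
  "H01 \<Omega> u G \<longleftrightarrow> L2_on \<Omega> u \<and> L2_on \<Omega> G \<and> weak_gradient \<Omega> u G \<and>
     (\<exists>\<psi>. (\<forall>n. test_function \<Omega> (\<psi> n)) \<and>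
        (\<lambda>n::nat. LINT x|lebesgue_on \<Omega>. (\<psi> n x - u x)\<^sup>2) \<longlonglongrightarrow> 0 \<and>
        (\<lambda>n. LINT x|lebesgue_on \<Omega>. (norm (grad (\<psi> n) x - G x))\<^sup>2) \<longlonglongrightarrow> 0)"

definition dirichlet_eigenfunction ::
  "'a::euclidean_space set \<Rightarrow> real \<Rightarrow> ('a \<Rightarrow> real) \<Rightarrow> bool" where
  "dirichlet_eigenfunction \<Omega> l u \<longleftrightarrow> \<not> (AE x in lebesgue_on \<Omega>. u x = 0) \<and>
     (\<exists>G. H01 \<Omega> u G \<and> (\<forall>v H. H01 \<Omega> v H \<longrightarrow>
        (LINT x|lebesgue_on \<Omega>. G x \<bullet> H x) = l * (LINT x|lebesgue_on \<Omega>. u x * v x)))"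

definition first_dirichlet_eigenvalue :: "'a::euclidean_space set \<Rightarrow> real \<Rightarrow> bool" where
  "first_dirichlet_eigenvalue \<Omega> l \<longleftrightarrow> (\<exists>u. dirichlet_eigenfunction \<Omega> l u) \<and>
     (\<forall>l' u. dirichlet_eigenfunction \<Omega> l' u \<longrightarrow> l \<le> l')"

text \<open>The integral of \<open>\<phi>/\<alpha>\<close> with values in [0,\<open>\<infinity>\<close>]. The division is that of \<open>ennreal\<close>, so the
  integrand is \<open>\<infinity>\<close> where \<open>\<alpha>\<close> vanishes and \<open>\<phi>\<close> is positive; real division would give 0 there.\<close>
definition quotient_integral ::
  "'a::euclidean_space set \<Rightarrow> ('a \<Rightarrow> real) \<Rightarrow> ('a \<Rightarrow> real) \<Rightarrow> ennreal" where
  "quotient_integral \<Omega> \<phi> \<alpha> = (\<integral>\<^sup>+x. ennreal (\<phi> x) / ennreal (\<alpha> x) \<partial>lebesgue_on \<Omega>)"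

end

theory Submission
  imports Defs "HOL-Computational_Algebra.Polynomial"
begin

text \<open>Put \<open>h = - \<Delta> w\<close>. Testing the weak eigenvalue equation with \<open>w\<close> gives
  \<open>\<integral> h \<phi> = \<lambda>\<^sub>1 \<integral> w \<phi> \<le> \<lambda>\<^sub>1\<close>, while \<open>h \<ge> c \<alpha>\<close> with \<open>c = \<lambda> f(0)\<close>. Integrating
  \<open>\<phi>/\<alpha> \<ge> 2 s \<phi> - s\<^sup>2 \<alpha> \<phi> \<ge> 2 s \<phi> - (s\<^sup>2/c) h \<phi>\<close> with \<open>s = c/\<lambda>\<^sub>1\<close> yields
  \<open>\<integral> \<phi>/\<alpha> \<ge> s (2 - \<integral> w \<phi>) \<ge> s \<integral> w \<phi>\<close>, which is the claim.

  A classical \<open>w\<close> need not have a gradient that is continuous up to the boundary, so it is not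
  immediately an admissible test function. Its truncations at small positive levels are \<open>C\<^sup>1\<close> with
  compact support, and mollification puts them in \<open>H\<^sub>0\<^sup>1\<close>. Testing \<open>- \<Delta> w = h\<close> with them bounds
  \<open>\<nabla> w\<close> in \<open>L\<^sup>2\<close>, and then both \<open>\<integral> h \<phi>\<close> and \<open>\<lambda>\<^sub>1 \<integral> w \<phi>\<close> equal \<open>\<integral> \<nabla> w \<bullet> \<nabla> \<phi>\<close>: the former by
  approximating \<open>\<phi>\<close> by test functions, the latter by letting the level tend to 0.\<close>

section \<open>Bump functions\<close>

lemma tendsto_poly_div_exp_at_top: "((\<lambda>x. poly p x * exp (- x)) \<longlongrightarrow> (0::real)) at_top"
proof -
  have "((\<lambda>x. \<Sum>i\<le>degree p. coeff p i * (x ^ i / exp x)) \<longlongrightarrow> (\<Sum>i\<le>degree p. coeff p i * 0)) at_top"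
    by (intro tendsto_sum tendsto_mult tendsto_const tendsto_power_div_exp_0)
  then show ?thesis
    by (simp add: poly_altdef exp_minus divide_inverse sum_distrib_right mult.assoc)
qed

text \<open>For \<open>p = 1\<close> this is the standard smooth function exp(-1/t), extended by 0
  to t \<le> 0. The polynomial factor in 1/t makes the family closed under differentiation.\<close>

definition flat_exp :: "real poly \<Rightarrow> real \<Rightarrow> real" where
  "flat_exp p t = (if 0 < t then poly p (1 / t) * exp (- (1 / t)) else 0)"

text \<open>On the right of 0 the substitution x = 1/t turns the claim into the decay of a
  polynomial times exp(-x) at infinity.\<close>

lemma isCont_flat_exp_0: "isCont (flat_exp p) 0"
proof -
  have "(flat_exp p \<longlongrightarrow> 0) (at_right 0)"
  proof (rule Lim_transform_eventually)
    show "((\<lambda>t. poly p (inverse t) * exp (- inverse t)) \<longlongrightarrow> 0) (at_right 0)"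
      using filterlim_compose[OF tendsto_poly_div_exp_at_top filterlim_inverse_at_top_right] .
    show "\<forall>\<^sub>F t in at_right 0. poly p (inverse t) * exp (- inverse t) = flat_exp p t"
      by (auto simp: eventually_at_right_field flat_exp_def inverse_eq_divide intro!: exI[of _ 1])
  qed
  moreover have "(flat_exp p \<longlongrightarrow> 0) (at_left 0)"
  proof (rule Lim_transform_eventually)
    show "\<forall>\<^sub>F t in at_left 0. 0 = flat_exp p t"
      by (auto simp: eventually_at_left_field flat_exp_def intro!: exI[of _ "-1"])
  qed simp
  ultimately show ?thesis
    by (simp add: isCont_def filterlim_split_at flat_exp_def)
qed

text \<open>For t > 0 both the chain rule for p(1/t) and the derivative of exp(-1/t) produce a
  factor 1/t^2, which is the polynomial \<open>[:0, 0, 1:]\<close> evaluated at 1/t.\<close>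

lemma DERIV_flat_exp:
  "(flat_exp p has_real_derivative flat_exp ([:0, 0, 1:] * (p - pderiv p)) t) (at t)"
proof -
  consider "0 < t" | "t < 0" | "t = 0" by linarith
  then show ?thesis
  proof cases
    case 1
    have "((\<lambda>t. poly p (1 / t) * exp (- (1 / t))) has_real_derivative
        flat_exp ([:0, 0, 1:] * (p - pderiv p)) t) (at t)"
      using 1 by (auto intro!: derivative_eq_intros poly_DERIV[THEN DERIV_chain2]
          simp: flat_exp_def field_simps power2_eq_square)
    then show ?thesis
      by (rule has_field_derivative_transform_within_open[of _ _ _ "{0<..}"])
        (use 1 in \<open>auto simp: flat_exp_def\<close>)
  next
    case 2
    have "((\<lambda>t. 0) has_real_derivative flat_exp ([:0, 0, 1:] * (p - pderiv p)) t) (at t)"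
      using 2 by (simp add: flat_exp_def)
    then show ?thesis
      by (rule has_field_derivative_transform_within_open[of _ _ _ "{..<0}"])
        (use 2 in \<open>auto simp: flat_exp_def\<close>)
  next
    case 3
    \<comment> \<open>Dividing by h multiplies the polynomial in 1/h by its variable, so the
      difference quotient at 0 is again a member of the family, and its continuity at 0 gives the
      limit.\<close>
    have "((\<lambda>h. (flat_exp p (0 + h) - flat_exp p 0) / h) \<longlongrightarrow> 0) (at 0)"
    proof (rule Lim_transform_eventually)
      show "(flat_exp (pCons 0 p) \<longlongrightarrow> 0) (at 0)"
        using isCont_flat_exp_0[of "pCons 0 p"] by (simp add: isCont_def flat_exp_def)
      show "\<forall>\<^sub>F h in at 0. flat_exp (pCons 0 p) h = (flat_exp p (0 + h) - flat_exp p 0) / h"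
        by (auto simp: flat_exp_def eventually_at_filter)
    qed
    then show ?thesis
      using 3 by (simp add: DERIV_def flat_exp_def)
  qed
qed

text \<open>A family containing the bump functions and closed under partial derivatives, whence all its
  members are smooth.\<close>
inductive bump_like :: "('a::euclidean_space \<Rightarrow> real) \<Rightarrow> bool" where
  flat_exp: "bump_like (\<lambda>x. flat_exp p (c - x \<bullet> x))"
| const: "bump_like (\<lambda>x. c)"
| inner: "bump_like (\<lambda>x. x \<bullet> b)"
| add: "bump_like u \<Longrightarrow> bump_like v \<Longrightarrow> bump_like (\<lambda>x. u x + v x)"
| mult: "bump_like u \<Longrightarrow> bump_like v \<Longrightarrow> bump_like (\<lambda>x. u x * v x)"

text \<open>Every component of the gradient stays in the family, so that inductions on the order of
  differentiability can apply their hypothesis to it.\<close>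

lemma bump_like_GDERIV:
  assumes "bump_like u"
  obtains D where "\<And>x. GDERIV u x :> D x" "\<And>b. bump_like (\<lambda>x. D x \<bullet> b)"
proof -
  from assms have "\<exists>D. (\<forall>x. GDERIV u x :> D x) \<and> (\<forall>b. bump_like (\<lambda>x. D x \<bullet> b))"
  proof induction
    case (flat_exp p c)
    let ?q = "[:0, 0, 1:] * (p - pderiv p)"
    have "GDERIV (\<lambda>x::'a. c - x \<bullet> x) x :> (-2) *\<^sub>R x" for x
      unfolding gderiv_def by (auto intro!: derivative_eq_intros simp: inner_commute)
    then have "GDERIV (\<lambda>x. flat_exp p (c - x \<bullet> x)) x :> flat_exp ?q (c - x \<bullet> x) *\<^sub>R ((-2) *\<^sub>R x)"
      for x :: 'a by (rule GDERIV_DERIV_compose[OF _ DERIV_flat_exp])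
    moreover have "bump_like (\<lambda>x::'a. flat_exp ?q (c - x \<bullet> x) * ((-2) * (x \<bullet> b)))" for b
      by (intro bump_like.intros)
    ultimately show ?case
      by (intro exI[of _ "\<lambda>x. flat_exp ?q (c - x \<bullet> x) *\<^sub>R ((-2) *\<^sub>R x)"]) (simp add: mult.assoc)
  next
    case (const c)
    then show ?case
      by (intro exI[of _ "\<lambda>x. 0"]) (auto intro: GDERIV_const bump_like.const)
  next
    case (inner b)
    show ?case
      by (intro exI[of _ "\<lambda>x. b"])
        (auto simp: gderiv_def intro!: bump_like.const derivative_eq_intros)
  next
    case (add u v)
    then obtain Du Dv where "\<And>x. GDERIV u x :> Du x" "\<And>x. GDERIV v x :> Dv x"
      "\<And>b. bump_like (\<lambda>x. Du x \<bullet> b)" "\<And>b. bump_like (\<lambda>x. Dv x \<bullet> b)" by auto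
    then show ?case
      by (intro exI[of _ "\<lambda>x. Du x + Dv x"]) (auto intro!: GDERIV_add bump_like.add simp: inner_add_left)
  next
    case (mult u v)
    then obtain Du Dv where "\<And>x. GDERIV u x :> Du x" "\<And>x. GDERIV v x :> Dv x"
      "\<And>b. bump_like (\<lambda>x. Du x \<bullet> b)" "\<And>b. bump_like (\<lambda>x. Dv x \<bullet> b)" by auto
    then show ?case using mult
      by (intro exI[of _ "\<lambda>x. u x *\<^sub>R Dv x + v x *\<^sub>R Du x"])
        (auto intro!: GDERIV_mult bump_like.add bump_like.mult simp: inner_add_left)
  qed
  then show thesis using that by blast
qed

section \<open>Gradients and smoothness of bump functions\<close>

lemma GDERIV_isCont: "GDERIV u x :> D \<Longrightarrow> isCont u x"
  unfolding gderiv_def by (rule has_derivative_continuous)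

lemma GDERIV_imp_frechet_derivative: "GDERIV u x :> D \<Longrightarrow> frechet_derivative u (at x) = (\<lambda>h. h \<bullet> D)"
  unfolding gderiv_def by (rule frechet_derivative_at[symmetric])

lemma GDERIV_imp_grad:
  fixes D :: "'a::euclidean_space"
  assumes "GDERIV u x :> D" shows "grad u x = D"
  by (simp add: grad_def GDERIV_imp_frechet_derivative[OF assms] inner_commute[of _ D]
      euclidean_representation)

lemma differentiable_imp_GDERIV_grad:
  fixes u :: "'a::euclidean_space \<Rightarrow> real"
  assumes "u differentiable (at x)" shows "GDERIV u x :> grad u x"
proof -
  have *: "(u has_derivative frechet_derivative u (at x)) (at x)"
    using assms by (simp add: frechet_derivative_works)
  then interpret linear "frechet_derivative u (at x)"
    by (rule has_derivative_linear)
  have "frechet_derivative u (at x) h = h \<bullet> grad u x" for h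
    by (subst (1) euclidean_representation[symmetric, of h])
      (simp add: sum scale grad_def inner_sum_right mult.commute)
  with * show ?thesis unfolding gderiv_def by (metis (no_types, lifting) ext)
qed

lemma bump_like_Ck_on: "bump_like u \<Longrightarrow> Ck_on k UNIV u"
proof (induction k arbitrary: u)
  case 0
  then obtain D where "\<And>x. GDERIV u x :> D x" by (rule bump_like_GDERIV) blast
  then show ?case
    by (auto intro!: continuous_at_imp_continuous_on GDERIV_isCont)
next
  case (Suc k)
  from Suc.prems obtain D where D: "\<And>x. GDERIV u x :> D x" "\<And>b. bump_like (\<lambda>x. D x \<bullet> b)"
    by (rule bump_like_GDERIV) blast
  have "u differentiable (at x)" for x
    using D(1)[of x] unfolding gderiv_def differentiable_def by blast
  then show ?case
    using Suc.IH[OF D(2)] by (simp add: GDERIV_imp_frechet_derivative[OF D(1)] inner_commute)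
qed

section \<open>Mollification\<close>

text \<open>The kernel is scalar, but the other factor may be vector valued, so that gradients can
  be convolved as well.\<close>

definition convol ::
  "('a::euclidean_space \<Rightarrow> real) \<Rightarrow> ('a \<Rightarrow> 'b::euclidean_space) \<Rightarrow> 'a \<Rightarrow> 'b" where
  "convol k u x = (LINT y|lborel. k y *\<^sub>R u (x - y))"

lemma integrable_continuous_compact_support:
  fixes f :: "'a::euclidean_space \<Rightarrow> 'b::{banach, second_countable_topology}"
  assumes "continuous_on UNIV f" "compact K" "\<And>x. x \<notin> K \<Longrightarrow> f x = 0"
  shows "integrable lborel f"
proof -
  have "(\<lambda>x. indicator K x *\<^sub>R f x) = f"
    using assms(3) by (auto simp: fun_eq_iff indicator_def)
  then show ?thesis
    using borel_integrable_compact[OF assms(2) continuous_on_subset[OF assms(1) subset_UNIV]] by simp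
qed

lemma lborel_integral_reflection:
  fixes f :: "'a::euclidean_space \<Rightarrow> 'b::{banach, second_countable_topology}"
  assumes [measurable]: "f \<in> borel_measurable borel"
  shows "(LINT x|lborel. f (c - x)) = integral\<^sup>L lborel f"
  by (subst (2) lborel_affine[of "-1" c]) (auto simp: integral_distr density_1)

text \<open>Allows the derivatives to be put on either factor: on the mollifier for smoothness, on
  the mollified function for the approximation of its gradient.\<close>

lemma convol_commute:
  fixes u v :: "'a::euclidean_space \<Rightarrow> real"
  assumes "continuous_on UNIV u" "continuous_on UNIV v"
  shows "convol u v = convol v u"
proof
  fix x
  have "(\<lambda>y. v y * u (x - y)) \<in> borel_measurable borel"
    by (intro borel_measurable_continuous_onI continuous_intros continuous_on_compose2[OF assms(1)]
        continuous_on_compose2[OF assms(2)]) auto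
  from lborel_integral_reflection[OF this, of x] show "convol u v x = convol v u x"
    by (simp add: convol_def mult.commute)
qed

text \<open>Passes to an integral over a fixed box, the form in which the Leibniz rule
  applies.\<close>

lemma convol_eq_integral_cbox:
  fixes u :: "'a::euclidean_space \<Rightarrow> 'b::euclidean_space"
  assumes "continuous_on UNIV k" "continuous_on UNIV u" "\<And>y. y \<notin> cbox a b \<Longrightarrow> k y = 0"
  shows "convol k u x = integral (cbox a b) (\<lambda>y. k y *\<^sub>R u (x - y))"
proof -
  have *: "continuous_on UNIV (\<lambda>y. k y *\<^sub>R u (x - y))"
    by (intro continuous_intros assms(1) continuous_on_compose2[OF assms(2)]) auto
  have "(\<lambda>y. indicator (cbox a b) y *\<^sub>R k y *\<^sub>R u (x - y)) = (\<lambda>y. k y *\<^sub>R u (x - y))"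
    using assms(3) by (auto simp: fun_eq_iff indicator_def)
  moreover have "set_integrable lborel (cbox a b) (\<lambda>y. k y *\<^sub>R u (x - y))"
    unfolding set_integrable_def
    by (intro borel_integrable_compact compact_cbox continuous_on_subset[OF *]) auto
  ultimately show ?thesis
    by (auto simp: convol_def set_lebesgue_integral_def dest: set_borel_integral_eq_integral(2))
qed

text \<open>Differentiation under the integral sign. The kernel \<open>k\<close> need only be
  continuous with compact support, so a mollifier, a cutoff or the function to be smoothed can take
  its place.\<close>

lemma GDERIV_convol:
  fixes u :: "'a::euclidean_space \<Rightarrow> real"
  assumes k: "continuous_on UNIV k" "compact K" "\<And>y. y \<notin> K \<Longrightarrow> k y = 0"
    and u: "\<And>x. GDERIV u x :> Du x" "continuous_on UNIV Du"
  shows "GDERIV (convol k u) x :> convol k Du x"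
proof -
  obtain a b where ab: "K \<subseteq> cbox a b"
    using bounded_subset_cbox_symmetric[OF compact_imp_bounded[OF k(2)]] by metis
  have cu: "continuous_on UNIV u"
    by (auto intro!: continuous_at_imp_continuous_on GDERIV_isCont u)
  have eq: "convol k U = (\<lambda>x. integral (cbox a b) (\<lambda>y. k y *\<^sub>R U (x - y)))"
    if "continuous_on UNIV U" for U :: "'a \<Rightarrow> 'c::euclidean_space"
    using convol_eq_integral_cbox[OF k(1) that] k(3) ab by blast
  have int: "(\<lambda>y. k y *\<^sub>R Du (x - y)) integrable_on cbox a b"
    by (intro integrable_continuous continuous_intros continuous_on_subset[OF k(1)]
        continuous_on_compose2[OF u(2)]) auto
  \<comment> \<open>The Leibniz rule wants the derivative as a bounded linear map, hence the
    gradient is wrapped in \<open>blinfun_inner_left\<close>, which linearity later pulls out of the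
    integral.\<close>
  have "((\<lambda>x. integral (cbox a b) (\<lambda>y. k y *\<^sub>R u (x - y))) has_derivative
      integral (cbox a b) (\<lambda>y. blinfun_inner_left (k y *\<^sub>R Du (x - y)))) (at x within UNIV)"
  proof (rule leibniz_rule[where fx = "\<lambda>x y. blinfun_inner_left (k y *\<^sub>R Du (x - y))"])
    fix x y
    have "((\<lambda>x. u (x - y)) has_derivative (\<lambda>h. h \<bullet> Du (x - y))) (at x)"
      by (rule has_derivative_compose[of "\<lambda>x. x - y" "\<lambda>h. h" x UNIV u "\<lambda>h. h \<bullet> Du (x - y)"])
        (use u(1)[of "x - y"] in \<open>auto simp: gderiv_def intro!: derivative_eq_intros\<close>)
    then show "((\<lambda>x. k y *\<^sub>R u (x - y)) has_derivative
        blinfun_apply (blinfun_inner_left (k y *\<^sub>R Du (x - y)))) (at x within UNIV)"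
      by (auto intro!: derivative_eq_intros)
  next
    show "(\<lambda>y. k y *\<^sub>R u (x - y)) integrable_on cbox a b" for x
      by (intro integrable_continuous continuous_intros continuous_on_subset[OF k(1)]
          continuous_on_compose2[OF cu]) auto
    show "continuous_on (UNIV \<times> cbox a b) (\<lambda>(x, y). blinfun_inner_left (k y *\<^sub>R Du (x - y)))"
      unfolding split_beta
      by (intro bounded_linear.continuous_on[OF bounded_linear_blinfun_inner_left]
          continuous_intros continuous_on_compose2[OF k(1)] continuous_on_compose2[OF u(2)]) auto
  qed auto
  moreover have "integral (cbox a b) (\<lambda>y. blinfun_inner_left (k y *\<^sub>R Du (x - y)))
      = blinfun_inner_left (integral (cbox a b) (\<lambda>y. k y *\<^sub>R Du (x - y)))"
    using integral_linear[OF int bounded_linear_blinfun_inner_left] by (simp add: o_def)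
  ultimately show ?thesis
    unfolding gderiv_def eq[OF cu] eq[OF u(2)] by (simp add: fun_eq_iff)
qed

text \<open>All derivatives fall on the bump factor. The induction varies \<open>u\<close>, since
  its step passes to the components of the gradient of \<open>u\<close>.\<close>

lemma convol_bump_like_Ck_on:
  assumes "continuous_on UNIV k" "compact K" "\<And>y. y \<notin> K \<Longrightarrow> k y = 0" "bump_like u"
  shows "Ck_on n UNIV (convol k u)"
  using assms(4)
proof (induction n arbitrary: u)
  case (0 u)
  from 0 obtain D where D: "\<And>x. GDERIV u x :> D x" "\<And>b. bump_like (\<lambda>x. D x \<bullet> b)"
    by (rule bump_like_GDERIV) blast
  have "continuous_on UNIV D"
    using D(2) bump_like_Ck_on[of _ 0] by (subst continuous_on_componentwise) auto
  then show ?case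
    using GDERIV_convol[OF assms(1-3) D(1)]
    by (auto intro!: continuous_at_imp_continuous_on GDERIV_isCont)
next
  case (Suc n u)
  from Suc.prems obtain D where D: "\<And>x. GDERIV u x :> D x" "\<And>b. bump_like (\<lambda>x. D x \<bullet> b)"
    by (rule bump_like_GDERIV) blast
  have cD: "continuous_on UNIV D"
    using D(2) bump_like_Ck_on[of _ 0] by (subst continuous_on_componentwise) auto
  note * = GDERIV_convol[OF assms(1-3) D(1) cD]
  have "b \<bullet> convol k D x = convol k (\<lambda>y. D y \<bullet> b) x" for b x
  proof -
    have "integrable lborel (\<lambda>y. k y *\<^sub>R D (x - y))"
      by (rule integrable_continuous_compact_support[OF _ assms(2)])
        (auto intro!: continuous_intros assms(1) continuous_on_compose2[OF cD] simp: assms(3))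
    from integral_inner_left[OF this, of b] show ?thesis
      by (simp add: convol_def inner_commute[of b])
  qed
  moreover have "convol k u differentiable (at x)" for x
    using *[of x] unfolding gderiv_def differentiable_def by blast
  ultimately show ?case
    using Suc.IH[OF D(2)] by (simp add: GDERIV_imp_frechet_derivative[OF *])
qed

text \<open>Functions are given on the whole space and vanish off a compact subset of
  \<open>S\<close>, so integrals over \<open>S\<close> and over the whole space agree. The gradient
  is an explicit argument.\<close>

definition C1_compact_support :: "'a::euclidean_space set \<Rightarrow> ('a \<Rightarrow> real) \<Rightarrow> ('a \<Rightarrow> 'a) \<Rightarrow> bool" where
  "C1_compact_support S v Dv \<longleftrightarrow> (\<forall>x. GDERIV v x :> Dv x) \<and> continuous_on UNIV Dv \<and>
     (\<exists>K. compact K \<and> K \<subseteq> S \<and> (\<forall>x. x \<notin> K \<longrightarrow> v x = 0))"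

lemma GDERIV_eq_0:
  assumes "GDERIV v x :> D" "open U" "x \<in> U" "\<And>y. y \<in> U \<Longrightarrow> v y = 0"
  shows "D = 0"
proof -
  have "(v has_derivative (\<lambda>h. 0)) (at x)"
    by (rule has_derivative_transform_within_open[OF _ assms(2,3), of "\<lambda>x. 0"]) (auto simp: assms(4))
  then have "(\<lambda>h. h \<bullet> D) = (\<lambda>h. 0)"
    using assms(1) unfolding gderiv_def by (rule has_derivative_unique[rotated])
  then show ?thesis by (metis inner_eq_zero_iff)
qed

text \<open>The gradient vanishes off \<open>K\<close> too, because the complement of
  \<open>K\<close> is open and the function is 0 on it.\<close>

lemma C1_compact_supportE:
  assumes "C1_compact_support S v Dv"
  obtains K where "compact K" "K \<subseteq> S" "\<And>x. x \<notin> K \<Longrightarrow> v x = 0" "\<And>x. x \<notin> K \<Longrightarrow> Dv x = 0"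
    "continuous_on UNIV v" "continuous_on UNIV Dv" "\<And>x. GDERIV v x :> Dv x"
proof -
  from assms obtain K where K: "compact K" "K \<subseteq> S" "\<And>x. x \<notin> K \<Longrightarrow> v x = 0"
    "continuous_on UNIV Dv" "\<And>x. GDERIV v x :> Dv x"
    by (auto simp: C1_compact_support_def)
  moreover have "Dv x = 0" if "x \<notin> K" for x
    by (rule GDERIV_eq_0[OF K(5), of "- K"]) (use K that in \<open>auto simp: compact_imp_closed\<close>)
  moreover have "continuous_on UNIV v"
    by (auto intro!: continuous_at_imp_continuous_on GDERIV_isCont K)
  ultimately show thesis using that by blast
qed

text \<open>Enlarge \<open>K\<close> by the closed unit ball. If one of two points at distance below
  1 lies in \<open>K\<close>, both lie in this compact set; if neither does, both values are
  0.\<close>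

lemma uniformly_continuous_compact_support:
  fixes f :: "'a::euclidean_space \<Rightarrow> 'b::real_normed_vector"
  assumes "continuous_on UNIV f" "compact K" "\<And>x. x \<notin> K \<Longrightarrow> f x = 0" "0 < e"
  obtains d where "0 < d" "\<And>x y. norm y < d \<Longrightarrow> norm (f (x - y) - f x) < e"
proof -
  let ?L = "{x + y | x y. x \<in> K \<and> y \<in> cball 0 1}"
  have "uniformly_continuous_on ?L f"
    by (intro compact_uniformly_continuous continuous_on_subset[OF assms(1)] compact_sums assms) auto
  then obtain d where d: "0 < d" "\<And>x y. x \<in> ?L \<Longrightarrow> y \<in> ?L \<Longrightarrow> dist y x < d \<Longrightarrow> dist (f y) (f x) < e"
    using uniformly_continuous_onE[OF _ assms(4)] by blast
  have "norm (f (x - y) - f x) < e" if y: "norm y < min d 1" for x y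
  proof (cases "x \<in> K \<or> x - y \<in> K")
    case True
    have "x \<in> ?L \<and> x - y \<in> ?L"
    proof -
      have "x = x + 0" "x = (x - y) + y" "x - y = x + (- y)" "x - y = (x - y) + 0" by auto
      moreover have "0 \<in> cball (0::'a) 1" "y \<in> cball 0 1" "- y \<in> cball 0 1"
        using y by auto
      ultimately show ?thesis using True by blast
    qed
    then show ?thesis
      using d(2)[of x "x - y"] y by (auto simp: dist_norm)
  qed (use assms in auto)
  then show thesis using that[of "min d 1"] d(1) by auto
qed

text \<open>The function exp(-1/(r^2 - |x|^2)) on the ball of radius \<open>r\<close>, extended by 0
  and divided by its integral.\<close>

lemma mollifier_exists:
  assumes "0 < r"
  obtains \<rho> :: "'a::euclidean_space \<Rightarrow> real"
  where "bump_like \<rho>" "\<And>x. 0 \<le> \<rho> x" "\<And>x. x \<notin> cball 0 r \<Longrightarrow> \<rho> x = 0" "integral\<^sup>L lborel \<rho> = 1"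
    "continuous_on UNIV \<rho>"
proof -
  define b where "b x = flat_exp 1 (r\<^sup>2 - x \<bullet> x)" for x :: 'a
  have bl: "bump_like b" unfolding b_def by (rule bump_like.intros)
  then have cb: "continuous_on UNIV b" using bump_like_Ck_on[of b 0] by simp
  have b0: "0 \<le> b x" for x by (simp add: b_def flat_exp_def)
  have bs: "b x = 0" if "x \<notin> cball 0 r" for x
  proof -
    have "r\<^sup>2 \<le> x \<bullet> x"
      using that assms by (auto simp: dot_square_norm intro!: power_mono)
    then show ?thesis by (simp add: b_def flat_exp_def)
  qed
  have int: "integrable lborel b"
    by (rule integrable_continuous_compact_support[OF cb compact_cball bs])
  \<comment> \<open>A nonnegative function with integral 0 vanishes almost everywhere, whereas
    \<open>b\<close> is positive on an open ball, which is not negligible.\<close>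
  have "integral\<^sup>L lborel b \<noteq> 0"
  proof
    assume "integral\<^sup>L lborel b = 0"
    then have "AE x in lborel. b x = 0"
      using integral_nonneg_eq_0_iff_AE[OF int] b0 by simp
    then have "AE x in lebesgue. b x = 0"
      by (rule AE_completion)
    moreover have "b x \<noteq> 0" if "x \<in> ball 0 r" for x
    proof -
      have "x \<bullet> x < r\<^sup>2"
        using that by (simp add: dot_square_norm power_strict_mono)
      then show ?thesis by (simp add: b_def flat_exp_def)
    qed
    ultimately have "negligible (ball (0::'a) r)"
      unfolding negligible_iff_null_sets
      by (auto simp: eventually_ae_filter elim!: null_sets_subset)
    then show False using assms open_not_negligible[of "ball (0::'a) r"] by auto
  qed
  moreover have "0 \<le> integral\<^sup>L lborel b" using b0 by simp
  ultimately have pos: "0 < integral\<^sup>L lborel b" by linarith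
  show thesis
  proof
    show "bump_like (\<lambda>x. (1 / integral\<^sup>L lborel b) * b x)"
      by (intro bump_like.mult bump_like.const bl)
  qed (use pos b0 bs in \<open>auto intro!: continuous_intros cb\<close>)
qed

text \<open>The kernel is a probability density on the ball of radius \<open>r\<close>, so the
  convolution averages the values \<open>u (x - y)\<close>, each within \<open>e\<close> of
  \<open>u x\<close>.\<close>

lemma convol_approx:
  fixes u :: "'a::euclidean_space \<Rightarrow> 'b::euclidean_space"
  assumes "continuous_on UNIV \<rho>" "\<And>x. 0 \<le> \<rho> x" "\<And>x. x \<notin> cball 0 r \<Longrightarrow> \<rho> x = 0"
    "integral\<^sup>L lborel \<rho> = 1" and u: "continuous_on UNIV u"
    and e: "\<And>y. norm y \<le> r \<Longrightarrow> norm (u (x - y) - u x) \<le> e"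
  shows "norm (convol \<rho> u x - u x) \<le> e"
proof -
  have int: "integrable lborel (\<lambda>y. \<rho> y *\<^sub>R U y)" if "continuous_on UNIV U"
    for U :: "'a \<Rightarrow> 'c::euclidean_space"
    by (rule integrable_continuous_compact_support[OF _ compact_cball[of 0 r]])
      (auto intro!: continuous_intros assms(1) that simp: assms(3))
  have int\<rho>: "integrable lborel \<rho>" using int[of "\<lambda>_. 1::real"] by simp
  have c: "continuous_on UNIV (\<lambda>y. u (x - y))"
    by (auto intro!: continuous_on_compose2[OF u] continuous_intros)
  have "u x = (LINT y|lborel. \<rho> y *\<^sub>R u x)"
    using int\<rho> by (simp add: assms(4))
  then have "convol \<rho> u x - u x = (LINT y|lborel. \<rho> y *\<^sub>R u (x - y) - \<rho> y *\<^sub>R u x)"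
    using Bochner_Integration.integral_diff[OF int[OF c] int[of "\<lambda>_. u x"]]
    by (simp add: convol_def)
  also have "norm \<dots> \<le> (LINT y|lborel. \<rho> y * e)"
  proof (rule Bochner_Integration.integral_norm_bound_integral)
    show "integrable lborel (\<lambda>y. \<rho> y *\<^sub>R u (x - y) - \<rho> y *\<^sub>R u x)"
      by (intro Bochner_Integration.integrable_diff int c continuous_intros)
    show "norm (\<rho> y *\<^sub>R u (x - y) - \<rho> y *\<^sub>R u x) \<le> \<rho> y * e" for y
    proof (cases "norm y \<le> r")
      case True
      then show ?thesis
        using e[OF True] assms(2)[of y]
        by (auto simp flip: scaleR_diff_right intro!: mult_left_mono)
    qed (use assms(3)[of y] in auto)
  qed (use int\<rho> in auto)
  also have "\<dots> = e" by (simp add: assms(4))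
  finally show ?thesis .
qed

text \<open>Mollification commutes with the gradient, so uniform continuity of \<open>v\<close> and
  of \<open>Dv\<close> controls both errors.\<close>

lemma test_function_approx:
  assumes v: "C1_compact_support S v Dv" and "open S" "0 < e"
  obtains \<psi> where "test_function S \<psi>" "\<And>x. \<bar>\<psi> x - v x\<bar> \<le> e" "\<And>x. norm (grad \<psi> x - Dv x) \<le> e"
proof -
  obtain K where K: "compact K" "K \<subseteq> S" "\<And>x. x \<notin> K \<Longrightarrow> v x = 0" "\<And>x. x \<notin> K \<Longrightarrow> Dv x = 0"
    "continuous_on UNIV v" "continuous_on UNIV Dv" "\<And>x. GDERIV v x :> Dv x"
    using C1_compact_supportE[OF v] by metis
  obtain d1 where d1: "0 < d1" "\<And>x y. norm y < d1 \<Longrightarrow> norm (v (x - y) - v x) < e"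
    using uniformly_continuous_compact_support[OF K(5,1,3) \<open>0 < e\<close>] by metis
  obtain d2 where d2: "0 < d2" "\<And>x y. norm y < d2 \<Longrightarrow> norm (Dv (x - y) - Dv x) < e"
    using uniformly_continuous_compact_support[OF K(6,1,4) \<open>0 < e\<close>] by metis
  obtain d3 where d3: "0 < d3" "(\<Union>x\<in>K. ball x d3) \<subseteq> S"
    using compact_subset_open_imp_ball_epsilon_subset[OF K(1) \<open>open S\<close> K(2)] by metis
  \<comment> \<open>Below \<open>d1\<close> and \<open>d2\<close> the two errors are at most
    \<open>e\<close>; below \<open>d3\<close> the support of the mollification stays inside
    \<open>S\<close>.\<close>
  define r where "r = min d1 (min d2 d3) / 2"
  have r: "0 < r" "r < d1" "r < d2" "r < d3" using d1(1) d2(1) d3(1) by (auto simp: r_def)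
  obtain \<rho> :: "'a \<Rightarrow> real" where \<rho>: "bump_like \<rho>" "\<And>x. 0 \<le> \<rho> x" "\<And>x. x \<notin> cball 0 r \<Longrightarrow> \<rho> x = 0"
    "integral\<^sup>L lborel \<rho> = 1" "continuous_on UNIV \<rho>"
    using mollifier_exists[OF r(1)] by metis
  let ?\<psi> = "convol \<rho> v"
  let ?L = "{x + y | x y. x \<in> K \<and> y \<in> cball 0 r}"
  have "?\<psi> x = 0" if "x \<notin> ?L" for x
  proof -
    have "\<rho> y * v (x - y) = 0" for y
    proof (rule ccontr)
      assume "\<rho> y * v (x - y) \<noteq> 0"
      then have "x - y \<in> K" "y \<in> cball 0 r" using K(3) \<rho>(3) by auto
      moreover have "x = (x - y) + y" by simp
      ultimately show False using that by blast
    qed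
    then show ?thesis unfolding convol_def real_scaleR_def by (simp only: integral_zero)
  qed
  then have sub: "{x. ?\<psi> x \<noteq> 0} \<subseteq> ?L" by blast
  have L: "compact ?L" by (intro compact_sums K compact_cball)
  then have cl: "closure {x. ?\<psi> x \<noteq> 0} \<subseteq> ?L"
    using sub by (intro closure_minimal compact_imp_closed)
  moreover have "?L \<subseteq> S"
  proof
    fix z assume "z \<in> ?L"
    then obtain x y where "z = x + y" "x \<in> K" "norm y \<le> r" by auto
    then have "z \<in> ball x d3" using r by (simp add: dist_norm)
    then show "z \<in> S" using d3(2) \<open>x \<in> K\<close> by blast
  qed
  moreover have "compact (closure {x. ?\<psi> x \<noteq> 0})"
    using compact_closure bounded_subset[OF compact_imp_bounded[OF L] sub] by blast
  \<comment> \<open>Here \<open>v\<close> acts as the kernel and the smooth mollifier is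
    differentiated.\<close>
  moreover have "smooth_on UNIV ?\<psi>"
    unfolding smooth_on_def convol_commute[OF \<rho>(5) K(5)]
    using convol_bump_like_Ck_on[OF K(5,1,3) \<rho>(1)] by blast
  ultimately have "test_function S ?\<psi>" by (simp add: test_function_def)
  moreover have "\<bar>?\<psi> x - v x\<bar> \<le> e" for x
    using convol_approx[OF \<rho>(5,2-4) K(5), where x = x and e = e] d1(2) r(2) by (force simp: less_imp_le)
  moreover have "grad ?\<psi> x = convol \<rho> Dv x" for x
    by (rule GDERIV_imp_grad[OF GDERIV_convol[OF \<rho>(5) compact_cball[of 0 r] \<rho>(3) K(7,6)]])
  moreover have "norm (convol \<rho> Dv x - Dv x) \<le> e" for x
    using convol_approx[OF \<rho>(5,2-4) K(6), where x = x and e = e] d2(2) r(3) by (force simp: less_imp_le)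
  ultimately show thesis using that by metis
qed

section \<open>Integration by parts\<close>

text \<open>Convolving \<open>v\<close> with a cutoff gives a function that is constant near 0 and
  whose gradient at 0 is the integral of \<open>Dv\<close> up to reflection. Differentiation under
  the integral sign thus takes the place of Fubini's theorem.\<close>

lemma integral_gradient_eq_0:
  assumes "C1_compact_support S v Dv"
  shows "integral\<^sup>L lborel Dv = 0"
proof -
  obtain K where K: "compact K" "K \<subseteq> S" "\<And>x. x \<notin> K \<Longrightarrow> v x = 0" "\<And>x. x \<notin> K \<Longrightarrow> Dv x = 0"
    "continuous_on UNIV v" "continuous_on UNIV Dv" "\<And>x. GDERIV v x :> Dv x"
    using C1_compact_supportE[OF assms] by metis
  obtain R where R: "\<And>x. x \<in> K \<Longrightarrow> norm x \<le> R"
    using compact_imp_bounded[OF K(1)] by (auto simp: bounded_iff)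
  \<comment> \<open>For |x| < 1 and y in \<open>K\<close> the point x - y has norm at most R + 1,
    where the cutoff is 1; it vanishes beyond R + 2.\<close>
  define k where "k y = max 0 (min 1 (R + 2 - norm y))" for y :: 'a
  have ck: "continuous_on UNIV k" unfolding k_def by (intro continuous_intros)
  have k0: "k y = 0" if "y \<notin> cball 0 (R + 2)" for y using that by (simp add: k_def)
  have k1: "k y = 1" if "norm y \<le> R + 1" for y using that by (simp add: k_def)
  \<comment> \<open>The cutoff \<open>k\<close> is 1 near the support, so the convolution is constant near 0.\<close>
  have const: "convol k v x = integral\<^sup>L lborel v" if "x \<in> ball 0 1" for x
  proof -
    have "v y * k (x - y) = v y" for y
    proof (cases "y \<in> K")
      case True
      then have "norm (x - y) \<le> R + 1"
        using R[of y] norm_triangle_ineq4[of x y] that by simp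
      then show ?thesis by (simp add: k1)
    qed (simp add: K(3))
    then show ?thesis
      unfolding convol_commute[OF ck K(5)] convol_def real_scaleR_def by (simp only:)
  qed
  have "GDERIV (convol k v) 0 :> convol k Dv 0"
    by (rule GDERIV_convol[OF ck compact_cball k0 K(7,6)])
  then have "GDERIV (\<lambda>x. convol k v x - integral\<^sup>L lborel v) 0 :> convol k Dv 0 - 0"
    by (intro GDERIV_diff GDERIV_const)
  then have "convol k Dv 0 - 0 = 0"
    by (rule GDERIV_eq_0[of _ _ _ "ball 0 1"]) (auto simp: const)
  moreover have "k y *\<^sub>R Dv (0 - y) = Dv (0 - y)" for y
    using K(4)[of "- y"] R[of "- y"] k1[of y] by (cases "- y \<in> K") auto
  ultimately have "(LINT y|lborel. Dv (0 - y)) = 0"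
    unfolding convol_def by simp
  then show ?thesis
    using lborel_integral_reflection[OF borel_measurable_continuous_onI[OF K(6)], of 0] by simp
qed

lemma integral_lebesgue_on_eq_lborel:
  fixes f :: "'a::euclidean_space \<Rightarrow> 'b::{banach, second_countable_topology}"
  assumes "S \<in> sets lebesgue" "f \<in> borel_measurable borel" "\<And>x. x \<notin> S \<Longrightarrow> f x = 0"
  shows "integral\<^sup>L (lebesgue_on S) f = integral\<^sup>L lborel f"
proof -
  have "(\<lambda>x. indicator S x *\<^sub>R f x) = f"
    using assms(3) by (auto simp: fun_eq_iff indicator_def)
  then show ?thesis
    using assms(1,2) by (simp add: integral_restrict_space integral_completion)
qed

lemma integrable_lebesgue_on_if_lborel:
  fixes f :: "'a::euclidean_space \<Rightarrow> 'b::{banach, second_countable_topology}"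
  assumes "S \<in> sets lebesgue" "integrable lborel f"
  shows "integrable (lebesgue_on S) f"
proof -
  have "integrable lebesgue f"
    using assms(2) by (simp add: integrable_completion)
  then show ?thesis
    using assms(1) by (simp add: integrable_restrict_space integrable_mult_indicator)
qed

text \<open>The open sets \<open>S\<close> and \<open>- K\<close> cover the space, and
  \<open>F\<close> is continuous on each.\<close>

lemma continuous_on_UNIV_extend:
  assumes "open S" "compact K" "K \<subseteq> S" "continuous_on S F" "\<And>x. x \<notin> K \<Longrightarrow> F x = 0"
  shows "continuous_on UNIV (F :: 'a::t2_space \<Rightarrow> 'b::{topological_space, zero})"
proof -
  have "continuous_on (- K) F"
    by (rule continuous_on_eq[OF continuous_on_const[of _ 0]]) (simp add: assms(5))
  then have "continuous_on (S \<union> - K) F"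
    using assms by (intro continuous_on_open_Un) (auto simp: compact_imp_closed open_Compl)
  moreover have "S \<union> - K = UNIV" using assms(3) by auto
  ultimately show ?thesis by simp
qed

lemma GDERIV_extend_0:
  assumes "open S" "compact K" "K \<subseteq> S" "\<And>x. x \<in> S \<Longrightarrow> GDERIV F x :> D x"
    "\<And>x. x \<notin> K \<Longrightarrow> F x = 0" "\<And>x. x \<notin> K \<Longrightarrow> D x = 0"
  shows "GDERIV F x :> D x"
proof (cases "x \<in> S")
  case False
  then have *: "x \<in> - K" "open (- K)" using assms(2,3) by (auto simp: compact_imp_closed)
  have "(F has_derivative (\<lambda>h. 0)) (at x)"
    by (rule has_derivative_transform_within_open[OF _ *(2,1), of "\<lambda>x. 0"]) (auto simp: assms(5))
  then show ?thesis using assms(6) \<open>x \<in> - K\<close> by (simp add: gderiv_def)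
qed (rule assms(4))

text \<open>The factor \<open>u\<close> is controlled only on \<open>S\<close>; elsewhere
  \<open>v\<close> and its gradient vanish, so the product extends by 0.\<close>

lemma C1_compact_support_mult:
  assumes v: "C1_compact_support S v Dv" and "open S"
    and u: "\<And>x. x \<in> S \<Longrightarrow> GDERIV u x :> Du x" "continuous_on S Du"
  shows "C1_compact_support S (\<lambda>x. v x * u x) (\<lambda>x. v x *\<^sub>R Du x + u x *\<^sub>R Dv x)"
proof -
  obtain K where K: "compact K" "K \<subseteq> S" "\<And>x. x \<notin> K \<Longrightarrow> v x = 0" "\<And>x. x \<notin> K \<Longrightarrow> Dv x = 0"
    "continuous_on UNIV v" "continuous_on UNIV Dv" "\<And>x. GDERIV v x :> Dv x"
    using C1_compact_supportE[OF v] by metis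
  have cu: "continuous_on S u"
    by (auto intro!: continuous_at_imp_continuous_on GDERIV_isCont u)
  have "continuous_on UNIV (\<lambda>x. v x *\<^sub>R Du x + u x *\<^sub>R Dv x)"
    by (rule continuous_on_UNIV_extend[OF \<open>open S\<close> K(1,2)])
      (auto intro!: continuous_intros u(2) cu continuous_on_subset[OF K(5)]
        continuous_on_subset[OF K(6)] simp: K(3,4))
  moreover have "GDERIV (\<lambda>x. v x * u x) x :> v x *\<^sub>R Du x + u x *\<^sub>R Dv x" for x
    by (rule GDERIV_extend_0[OF \<open>open S\<close> K(1,2)]) (simp_all add: GDERIV_mult u(1) K(3,4,7))
  ultimately show ?thesis
    unfolding C1_compact_support_def using K(1-3) by (auto intro!: exI[of _ K])
qed

text \<open>The gradient of the product \<open>v x * u x\<close> has integral 0. The vector-valued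
  form treats all partial derivatives at once.\<close>

lemma integration_by_parts_compact_support:
  assumes v: "C1_compact_support S v Dv" and "open S"
    and u: "\<And>x. x \<in> S \<Longrightarrow> GDERIV u x :> Du x" "continuous_on S Du"
  shows "integrable (lebesgue_on S) (\<lambda>x. u x *\<^sub>R Dv x)"
    and "integrable (lebesgue_on S) (\<lambda>x. v x *\<^sub>R Du x)"
    and "(LINT x|lebesgue_on S. u x *\<^sub>R Dv x) = - (LINT x|lebesgue_on S. v x *\<^sub>R Du x)"
proof -
  obtain K where K: "compact K" "K \<subseteq> S" "\<And>x. x \<notin> K \<Longrightarrow> v x = 0" "\<And>x. x \<notin> K \<Longrightarrow> Dv x = 0"
    "continuous_on UNIV v" "continuous_on UNIV Dv" "\<And>x. GDERIV v x :> Dv x"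
    using C1_compact_supportE[OF v] by metis
  have S: "S \<in> sets lebesgue" using \<open>open S\<close> by auto
  have cu: "continuous_on S u"
    by (auto intro!: continuous_at_imp_continuous_on GDERIV_isCont u)
  have c1: "continuous_on UNIV (\<lambda>x. v x *\<^sub>R Du x)"
    by (rule continuous_on_UNIV_extend[OF \<open>open S\<close> K(1,2)])
      (auto intro!: continuous_intros u(2) continuous_on_subset[OF K(5)] simp: K(3))
  have c2: "continuous_on UNIV (\<lambda>x. u x *\<^sub>R Dv x)"
    by (rule continuous_on_UNIV_extend[OF \<open>open S\<close> K(1,2)])
      (auto intro!: continuous_intros cu continuous_on_subset[OF K(6)] simp: K(4))
  have i1: "integrable lborel (\<lambda>x. v x *\<^sub>R Du x)"
    by (rule integrable_continuous_compact_support[OF c1 K(1)]) (simp add: K(3))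
  have i2: "integrable lborel (\<lambda>x. u x *\<^sub>R Dv x)"
    by (rule integrable_continuous_compact_support[OF c2 K(1)]) (simp add: K(4))
  show "integrable (lebesgue_on S) (\<lambda>x. u x *\<^sub>R Dv x)" "integrable (lebesgue_on S) (\<lambda>x. v x *\<^sub>R Du x)"
    using integrable_lebesgue_on_if_lborel[OF S] i1 i2 by auto
  have "(LINT x|lborel. v x *\<^sub>R Du x) + (LINT x|lborel. u x *\<^sub>R Dv x) = 0"
    using integral_gradient_eq_0[OF C1_compact_support_mult[OF assms]] i1 i2 by simp
  moreover have "(LINT x|lebesgue_on S. v x *\<^sub>R Du x) = (LINT x|lborel. v x *\<^sub>R Du x)"
    using K(2,3) by (intro integral_lebesgue_on_eq_lborel S borel_measurable_continuous_onI c1) auto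
  moreover have "(LINT x|lebesgue_on S. u x *\<^sub>R Dv x) = (LINT x|lborel. u x *\<^sub>R Dv x)"
    using K(2,4) by (intro integral_lebesgue_on_eq_lborel S borel_measurable_continuous_onI c2) auto
  ultimately show "(LINT x|lebesgue_on S. u x *\<^sub>R Dv x) = - (LINT x|lebesgue_on S. v x *\<^sub>R Du x)"
    by (simp add: eq_neg_iff_add_eq_0 add.commute)
qed

lemma Ck_on_Suc_GDERIV:
  fixes u :: "'a::euclidean_space \<Rightarrow> real"
  assumes "Ck_on (Suc n) S u" "x \<in> S"
  shows "GDERIV u x :> grad u x"
  using assms by (auto intro: differentiable_imp_GDERIV_grad)

lemma grad_inner_Basis: "b \<in> Basis \<Longrightarrow> grad u x \<bullet> b = frechet_derivative u (at x) b"
  by (simp add: grad_def)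

lemma Ck_on_imp_continuous_on: "Ck_on n S u \<Longrightarrow> continuous_on S u"
  by (cases n)
    (auto intro!: continuous_at_imp_continuous_on differentiable_imp_continuous_within)

lemma Ck_on_Suc_continuous_grad:
  assumes "Ck_on (Suc n) S u"
  shows "continuous_on S (grad u)"
proof -
  have "continuous_on S (\<lambda>x. frechet_derivative u (at x) b)" if "b \<in> Basis" for b
    using assms that by (auto intro: Ck_on_imp_continuous_on)
  then show ?thesis
    by (subst continuous_on_componentwise) (simp add: grad_inner_Basis)
qed

lemma test_function_C1_compact_support:
  assumes "test_function S \<psi>"
  shows "C1_compact_support S \<psi> (grad \<psi>)"
proof -
  have *: "Ck_on (Suc 0) UNIV \<psi>"
    using assms unfolding test_function_def smooth_on_def by blast
  show ?thesis
    unfolding C1_compact_support_def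
  proof (intro conjI allI exI)
    show "GDERIV \<psi> x :> grad \<psi> x" for x
      using Ck_on_Suc_GDERIV[OF *] by simp
    show "continuous_on UNIV (grad \<psi>)"
      by (rule Ck_on_Suc_continuous_grad[OF *])
    show "compact (closure {x. \<psi> x \<noteq> 0})" "closure {x. \<psi> x \<noteq> 0} \<subseteq> S"
      using assms unfolding test_function_def by simp_all
    show "x \<notin> closure {x. \<psi> x \<noteq> 0} \<longrightarrow> \<psi> x = 0" for x
      using closure_subset[of "{x. \<psi> x \<noteq> 0}"] by auto
  qed
qed

text \<open>Integrate by parts with each partial derivative of \<open>w\<close>, take the component
  in the same direction and sum. Compact support of \<open>v\<close> makes the behaviour of
  \<open>w\<close> at the boundary irrelevant.\<close>

lemma Green_compact_support:
  fixes w :: "'a::euclidean_space \<Rightarrow> real"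
  assumes v: "C1_compact_support S v Dv" and "open S" and w: "Ck_on 2 S w"
  shows "(LINT x|lebesgue_on S. Dv x \<bullet> grad w x) = - (LINT x|lebesgue_on S. v x * laplacian w x)"
proof -
  let ?d = "\<lambda>b y. frechet_derivative w (at y) b"
  have d: "Ck_on (Suc 0) S (?d b)" if "b \<in> Basis" for b
    using w that by (simp add: numeral_2_eq_2)
  have ibp: "integrable (lebesgue_on S) (\<lambda>x. ?d b x *\<^sub>R Dv x)"
    "integrable (lebesgue_on S) (\<lambda>x. v x *\<^sub>R grad (?d b) x)"
    "(LINT x|lebesgue_on S. ?d b x *\<^sub>R Dv x) = - (LINT x|lebesgue_on S. v x *\<^sub>R grad (?d b) x)"
    if "b \<in> Basis" for b
    using integration_by_parts_compact_support[OF v \<open>open S\<close> Ck_on_Suc_GDERIV[OF d[OF that]]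
        Ck_on_Suc_continuous_grad[OF d[OF that]]] by blast+
  have "(LINT x|lebesgue_on S. Dv x \<bullet> grad w x)
      = (LINT x|lebesgue_on S. (\<Sum>b\<in>Basis. (?d b x *\<^sub>R Dv x) \<bullet> b))"
    by (simp add: grad_def inner_sum_right)
  also have "\<dots> = (\<Sum>b\<in>Basis. (LINT x|lebesgue_on S. ?d b x *\<^sub>R Dv x) \<bullet> b)"
    by (subst Bochner_Integration.integral_sum[OF integrable_inner_left[OF ibp(1)]])
      (auto intro!: sum.cong integral_inner_left ibp(1) simp del: inner_scaleR_left)
  also have "\<dots> = (\<Sum>b\<in>Basis. - ((LINT x|lebesgue_on S. v x *\<^sub>R grad (?d b) x) \<bullet> b))"
    by (rule sum.cong) (simp_all add: ibp(3))
  also have "\<dots> = - (LINT x|lebesgue_on S. (\<Sum>b\<in>Basis. (v x *\<^sub>R grad (?d b) x) \<bullet> b))"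
    unfolding sum_negf by (subst Bochner_Integration.integral_sum[OF integrable_inner_left[OF ibp(2)]])
      (auto intro!: sum.cong integral_inner_left[symmetric] ibp(2) simp del: inner_scaleR_left)
  also have "(\<lambda>x. \<Sum>b\<in>Basis. (v x *\<^sub>R grad (?d b) x) \<bullet> b) = (\<lambda>x. v x * laplacian w x)"
    by (simp add: laplacian_def grad_inner_Basis sum_distrib_left)
  finally show ?thesis .
qed

section \<open>Square-integrable functions and membership in \<open>H01\<close>\<close>

lemma L2_on_inner_integrable:
  assumes "L2_on S f" "L2_on S g"
  shows "integrable (lebesgue_on S) (\<lambda>x. f x \<bullet> g x)"
proof (rule Bochner_Integration.integrable_bound)
  show "integrable (lebesgue_on S) (\<lambda>x. (norm (f x))\<^sup>2 + (norm (g x))\<^sup>2)"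
    using assms by (auto simp: L2_on_def)
  show "(\<lambda>x. f x \<bullet> g x) \<in> borel_measurable (lebesgue_on S)"
    using assms by (auto simp: L2_on_def)
  have "\<bar>f x \<bullet> g x\<bar> \<le> (norm (f x))\<^sup>2 + (norm (g x))\<^sup>2" for x
    using Cauchy_Schwarz_ineq2[of "f x" "g x"] sum_squares_bound[of "norm (f x)" "norm (g x)"]
      mult_nonneg_nonneg[OF norm_ge_zero[of "f x"] norm_ge_zero[of "g x"]]
    by linarith
  then show "AE x in lebesgue_on S. norm (f x \<bullet> g x) \<le> norm ((norm (f x))\<^sup>2 + (norm (g x))\<^sup>2)"
    by simp
qed

lemma L2_on_diff:
  assumes "L2_on S f" "L2_on S g"
  shows "L2_on S (\<lambda>x. f x - g x)"
proof -
  have eq: "(norm (f x - g x))\<^sup>2 = (norm (f x))\<^sup>2 + (norm (g x))\<^sup>2 - 2 * (f x \<bullet> g x)" for x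
    by (simp add: power2_norm_eq_inner inner_diff inner_commute)
  show ?thesis
    using assms L2_on_inner_integrable[OF assms] unfolding L2_on_def eq by auto
qed

text \<open>Strong convergence implies weak convergence; Young's inequality with a parameter
  \<open>t\<close> is used instead of the Cauchy-Schwarz inequality for integrals.\<close>

lemma L2_on_tendsto_inner:
  assumes f: "\<And>n. L2_on S (f n)" "L2_on S F" and g: "L2_on S g"
    and lim: "(\<lambda>n. LINT x|lebesgue_on S. (norm (f n x - F x))\<^sup>2) \<longlonglongrightarrow> 0"
  shows "(\<lambda>n. LINT x|lebesgue_on S. f n x \<bullet> g x) \<longlonglongrightarrow> (LINT x|lebesgue_on S. F x \<bullet> g x)"
proof (rule LIMSEQ_I)
  fix e :: real assume "0 < e"
  define B where "B = (LINT x|lebesgue_on S. (norm (g x))\<^sup>2)"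
  \<comment> \<open>Makes B/(2t) < e/2; the other half of \<open>e\<close> comes from a squared
    distance below e/t. The summand 1 keeps \<open>t\<close> positive when \<open>B\<close> is
    0.\<close>
  define t where "t = (B + 1) / e"
  have "0 \<le> B" by (simp add: B_def)
  then have t: "0 < t" "B / t < e" using \<open>0 < e\<close> by (auto simp: t_def field_simps)
  obtain N where N: "\<And>n. N \<le> n \<Longrightarrow> norm ((LINT x|lebesgue_on S. (norm (f n x - F x))\<^sup>2) - 0) < e / t"
    using LIMSEQ_D[OF lim, of "e / t"] t \<open>0 < e\<close> by auto
  have "norm ((LINT x|lebesgue_on S. f n x \<bullet> g x) - (LINT x|lebesgue_on S. F x \<bullet> g x)) < e"
    if "N \<le> n" for n
  proof -
    note d = L2_on_diff[OF f(1)[of n] f(2)]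
    have "(LINT x|lebesgue_on S. f n x \<bullet> g x) - (LINT x|lebesgue_on S. F x \<bullet> g x)
        = (LINT x|lebesgue_on S. (f n x - F x) \<bullet> g x)"
      by (simp add: inner_diff_left Bochner_Integration.integral_diff L2_on_inner_integrable f g)
    also have "norm \<dots> \<le> (LINT x|lebesgue_on S. t / 2 * (norm (f n x - F x))\<^sup>2 + (norm (g x))\<^sup>2 / (2 * t))"
    proof (rule Bochner_Integration.integral_norm_bound_integral)
      show "integrable (lebesgue_on S) (\<lambda>x. (f n x - F x) \<bullet> g x)"
        by (rule L2_on_inner_integrable[OF d g])
      show "integrable (lebesgue_on S) (\<lambda>x. t / 2 * (norm (f n x - F x))\<^sup>2 + (norm (g x))\<^sup>2 / (2 * t))"
        using d g by (auto simp: L2_on_def)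
      fix x
      let ?a = "norm (f n x - F x)" and ?b = "norm (g x)"
      \<comment> \<open>Expanding this square is Young's inequality for the product of the two
        norms.\<close>
      have "0 \<le> (t * ?a - ?b)\<^sup>2 / (2 * t)" using t by simp
      also have "\<dots> = t / 2 * ?a\<^sup>2 + ?b\<^sup>2 / (2 * t) - ?a * ?b"
        using t by (simp add: field_simps power2_eq_square)
      finally show "norm ((f n x - F x) \<bullet> g x) \<le> t / 2 * ?a\<^sup>2 + ?b\<^sup>2 / (2 * t)"
        using Cauchy_Schwarz_ineq2[of "f n x - F x" "g x"] by simp
    qed
    also have "\<dots> = t / 2 * (LINT x|lebesgue_on S. (norm (f n x - F x))\<^sup>2) + B / (2 * t)"
      using d g by (simp add: L2_on_def B_def)
    also have "\<dots> < t / 2 * (e / t) + e / 2"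
      using N[OF that] t by (intro add_strict_mono mult_strict_left_mono) auto
    also have "\<dots> = e" using t by simp
    finally show ?thesis .
  qed
  then show "\<exists>N. \<forall>n\<ge>N. norm ((LINT x|lebesgue_on S. f n x \<bullet> g x) - (LINT x|lebesgue_on S. F x \<bullet> g x)) < e"
    by blast
qed

lemma L2_on_continuous_compact_support:
  assumes "S \<in> sets lebesgue" "continuous_on UNIV f" "compact K" "\<And>x. x \<notin> K \<Longrightarrow> f x = 0"
  shows "L2_on S f"
proof -
  have "integrable lborel (\<lambda>x. (norm (f x))\<^sup>2)"
    by (rule integrable_continuous_compact_support[OF _ assms(3)])
      (auto intro!: continuous_intros assms(2) simp: assms(4))
  then show ?thesis
    using assms unfolding L2_on_def
    by (auto intro!: integrable_lebesgue_on_if_lborel continuous_imp_measurable_on_sets_lebesgue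
        intro: continuous_on_subset)
qed

lemma integral_bound_tendsto_0:
  assumes "finite_measure M" "\<And>n x. x \<in> space M \<Longrightarrow> 0 \<le> F n x" "\<And>n x. x \<in> space M \<Longrightarrow> F n x \<le> c n"
    and "c \<longlonglongrightarrow> (0::real)"
  shows "(\<lambda>n. integral\<^sup>L M (F n)) \<longlonglongrightarrow> 0"
proof (rule tendsto_sandwich[of "\<lambda>_. 0" _ _ "\<lambda>n. \<bar>c n\<bar> * measure M (space M)"])
  interpret finite_measure M by fact
  \<comment> \<open>On an empty space nothing forces \<open>c n\<close> to be nonnegative, hence the
    absolute value.\<close>
  have "integral\<^sup>L M (F n) \<le> (LINT x|M. \<bar>c n\<bar>)" for n
    using assms(2,3) by (intro integral_mono') (auto simp: abs_le_iff intro: order_trans[OF _ abs_ge_self])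
  then show "\<forall>\<^sub>F n in sequentially. integral\<^sup>L M (F n) \<le> \<bar>c n\<bar> * measure M (space M)"
    by (simp add: mult.commute)
  show "(\<lambda>n. \<bar>c n\<bar> * measure M (space M)) \<longlonglongrightarrow> 0"
    using assms(4) by (intro tendsto_mult_left_zero) (simp add: tendsto_rabs_zero)
qed (use assms(2) in \<open>auto intro!: always_eventually integral_nonneg\<close>)

text \<open>Mollifications converge uniformly together with their gradients, hence in L^2 because
  \<open>S\<close> has finite measure. Integration by parts identifies the classical gradient with
  the weak one.\<close>

lemma H01_C1_compact_support:
  assumes "open S" "bounded S" and v: "C1_compact_support S v Dv"
  shows "H01 S v Dv"
proof -
  obtain K where K: "compact K" "K \<subseteq> S" "\<And>x. x \<notin> K \<Longrightarrow> v x = 0" "\<And>x. x \<notin> K \<Longrightarrow> Dv x = 0"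
    "continuous_on UNIV v" "continuous_on UNIV Dv" "\<And>x. GDERIV v x :> Dv x"
    using C1_compact_supportE[OF v] by metis
  have S: "S \<in> sets lebesgue" using \<open>open S\<close> by auto
  have fin: "finite_measure (lebesgue_on S)"
    using assms by (intro finite_measure_lebesgue_on lmeasurable_open)
  have "\<exists>\<psi>. test_function S \<psi> \<and> (\<forall>x. \<bar>\<psi> x - v x\<bar> \<le> 1 / real (Suc n)) \<and>
      (\<forall>x. norm (grad \<psi> x - Dv x) \<le> 1 / real (Suc n))" for n
    using test_function_approx[OF v \<open>open S\<close>, of "1 / real (Suc n)"]
    by (metis of_nat_0_less_iff zero_less_Suc zero_less_divide_1_iff)
  then obtain \<psi> where \<psi>: "\<And>n. test_function S (\<psi> n)" "\<And>n x. \<bar>\<psi> n x - v x\<bar> \<le> 1 / real (Suc n)"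
    "\<And>n x. norm (grad (\<psi> n) x - Dv x) \<le> 1 / real (Suc n)"
    by metis
  have c: "(\<lambda>n. (1 / real (Suc n))\<^sup>2) \<longlonglongrightarrow> 0"
    using tendsto_power[OF LIMSEQ_inverse_real_of_nat, of 2]
    by (simp only: inverse_eq_divide power_zero_numeral)
  have "(\<lambda>n. LINT x|lebesgue_on S. (\<psi> n x - v x)\<^sup>2) \<longlonglongrightarrow> 0"
    using \<psi>(2) by (intro integral_bound_tendsto_0[OF fin _ _ c]) (auto simp: abs_le_square_iff[symmetric] simp del: of_nat_Suc)
  moreover have "(\<lambda>n. LINT x|lebesgue_on S. (norm (grad (\<psi> n) x - Dv x))\<^sup>2) \<longlonglongrightarrow> 0"
    using \<psi>(3) by (intro integral_bound_tendsto_0[OF fin _ _ c]) (auto intro!: power_mono simp del: of_nat_Suc)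
  moreover have "weak_gradient S v Dv"
    unfolding weak_gradient_def
    using integration_by_parts_compact_support(3)[OF test_function_C1_compact_support \<open>open S\<close> K(7)]
      continuous_on_subset[OF K(6)] by blast
  ultimately show ?thesis
    unfolding H01_def
    using L2_on_continuous_compact_support[OF S K(5,1,3)] L2_on_continuous_compact_support[OF S K(6,1,4)] \<psi>(1)
    by blast
qed

section \<open>Testing with a classical solution\<close>

text \<open>A \<open>C\<^sup>1\<close> version of the positive part of \<open>t - e\<close>: for \<open>t \<ge> e\<close> it is \<open>t - 2e + e\<^sup>2/t\<close>.\<close>
definition trunc :: "real \<Rightarrow> real \<Rightarrow> real" where
  "trunc e t = (max 0 (t - e))\<^sup>2 / (max 0 (t - e) + e)"

text \<open>The derivative of \<open>trunc e\<close>. The maximum makes it 0 below the level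
  \<open>e\<close> and keeps the denominator away from 0.\<close>

definition trunc' :: "real \<Rightarrow> real \<Rightarrow> real" where
  "trunc' e t = 1 - (e / max e t)\<^sup>2"

lemma DERIV_trunc:
  assumes "0 < e"
  shows "(trunc e has_real_derivative trunc' e t) (at t)"
proof -
  consider "t < e" | "e < t" | "t = e" by linarith
  then show ?thesis
  proof cases
    case 1
    show ?thesis
      by (rule has_field_derivative_transform_within_open[of "\<lambda>_. 0" _ _ "{..<e}"])
        (use 1 assms in \<open>auto simp: trunc_def trunc'_def\<close>)
  next
    case 2
    have "((\<lambda>t. (t - e)\<^sup>2 / t) has_real_derivative trunc' e t) (at t)"
      using 2 assms
      by (auto intro!: derivative_eq_intros simp: trunc'_def field_simps power2_eq_square)
    then show ?thesis
      by (rule has_field_derivative_transform_within_open[of _ _ _ "{e<..}"])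
        (use 2 assms in \<open>auto simp: trunc_def\<close>)
  next
    case 3
    have "((\<lambda>h. (trunc e (e + h) - trunc e e) / h) \<longlongrightarrow> 0) (at 0)"
    proof (rule Lim_null_comparison)
      \<comment> \<open>The numerator of \<open>trunc\<close> is quadratic in h, so the one-sided
        derivatives at the junction t = e are both 0.\<close>
      have "norm ((trunc e (e + h) - trunc e e) / h) \<le> \<bar>h\<bar> / e" for h
      proof (cases "0 < h")
        case True
        have "h / (h + e) \<le> h / e" using True assms by (intro divide_left_mono) auto
        then show ?thesis using True assms by (simp add: trunc_def power2_eq_square)
      qed (use assms in \<open>simp add: trunc_def divide_nonpos_pos\<close>)
      then show "\<forall>\<^sub>F h in at 0. norm ((trunc e (e + h) - trunc e e) / h) \<le> \<bar>h\<bar> / e"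
        by simp
      show "((\<lambda>h. \<bar>h\<bar> / e) \<longlongrightarrow> 0) (at 0)"
        by (auto intro!: tendsto_eq_intros simp: assms[THEN less_imp_neq, symmetric])
    qed
    then show ?thesis
      using 3 assms by (simp add: DERIV_def trunc'_def)
  qed
qed

lemma trunc_bounds:
  assumes "0 < e" "0 \<le> t"
  shows "0 \<le> trunc e t" "trunc e t \<le> t"
proof -
  show "0 \<le> trunc e t" using assms by (simp add: trunc_def)
  show "trunc e t \<le> t"
  proof (cases "e < t")
    case True
    then have "(t - e) * (t - e) \<le> t * t" using assms by (intro mult_mono) auto
    then show ?thesis using True assms by (simp add: trunc_def field_simps power2_eq_square)
  qed (use assms in \<open>simp add: trunc_def\<close>)
qed

lemma trunc'_bounds:
  assumes "0 < e" shows "0 \<le> trunc' e t" "trunc' e t \<le> 1"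
  using assms by (auto simp: trunc'_def power_le_one_iff)

lemma trunc_tendsto:
  assumes "e \<longlonglongrightarrow> 0" "0 \<le> t" "\<And>n. 0 < e n"
  shows "(\<lambda>n. trunc (e n) t) \<longlonglongrightarrow> t"
proof (cases "t = 0")
  case True
  then show ?thesis using assms(3)[THEN less_imp_le] by (simp add: trunc_def)
next
  case False
  have "(\<lambda>n. trunc (e n) t) \<longlonglongrightarrow> (max 0 (t - 0))\<^sup>2 / (max 0 (t - 0) + 0)"
    unfolding trunc_def using False assms by (intro tendsto_intros) auto
  then show ?thesis using assms(2) by (simp add: power2_eq_square)
qed

text \<open>The limit fails at t = 0, where \<open>trunc'\<close> is 0 for every positive level;
  such points are dealt with by \<open>grad_eq_0_if_w_eq_0\<close>.\<close>

lemma trunc'_tendsto: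
  assumes "e \<longlonglongrightarrow> 0" "0 < t"
  shows "(\<lambda>n. trunc' (e n) t) \<longlonglongrightarrow> 1"
proof -
  have "(\<lambda>n. trunc' (e n) t) \<longlonglongrightarrow> 1 - (0 / max 0 t)\<^sup>2"
    unfolding trunc'_def using assms by (intro tendsto_intros) auto
  then show ?thesis by simp
qed

section \<open>Classical functions vanishing on the boundary and their truncations\<close>

lemma L2_on_bounded:
  assumes "finite_measure (lebesgue_on S)" "f \<in> borel_measurable (lebesgue_on S)"
    and "\<And>x. x \<in> S \<Longrightarrow> norm (f x) \<le> B"
  shows "L2_on S f"
proof -
  interpret finite_measure "lebesgue_on S" by fact
  have "integrable (lebesgue_on S) (\<lambda>x. (norm (f x))\<^sup>2)"
    by (rule integrable_const_bound[where B = "B\<^sup>2"])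
      (use assms(2,3) in \<open>auto intro!: AE_I2 power_mono\<close>)
  with assms(2) show ?thesis by (simp add: L2_on_def)
qed

lemma Ck_on_2_continuous_laplacian:
  assumes "Ck_on 2 S w" shows "continuous_on S (laplacian w)"
  using assms unfolding laplacian_def by (intro continuous_on_sum) (simp add: numeral_2_eq_2)

text \<open>Collects what each component of a solution provides separately; of its equation only the
  boundedness of the Laplacian is kept.\<close>

locale dirichlet_C2 =
  fixes \<Omega> :: "'a::euclidean_space set" and w :: "'a \<Rightarrow> real" and B :: real
  assumes open_\<Omega>: "open \<Omega>" and bounded_\<Omega>: "bounded \<Omega>"
    and C2: "Ck_on 2 \<Omega> w" and cont: "continuous_on (closure \<Omega>) w"
    and nonneg: "\<And>x. x \<in> \<Omega> \<Longrightarrow> 0 \<le> w x" and le_1: "\<And>x. x \<in> \<Omega> \<Longrightarrow> w x \<le> 1"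
    and boundary: "\<And>x. x \<in> frontier \<Omega> \<Longrightarrow> w x = 0"
    and laplacian_bound: "\<And>x. x \<in> \<Omega> \<Longrightarrow> \<bar>laplacian w x\<bar> \<le> B"
begin

lemma sets_\<Omega>: "\<Omega> \<in> sets lebesgue"
  using open_\<Omega> by auto

lemma finite_measure_\<Omega>: "finite_measure (lebesgue_on \<Omega>)"
  using open_\<Omega> bounded_\<Omega> by (intro finite_measure_lebesgue_on lmeasurable_open)

lemma GDERIV_w: "x \<in> \<Omega> \<Longrightarrow> GDERIV w x :> grad w x"
  using C2 Ck_on_Suc_GDERIV[of 1 \<Omega> w x] by (simp add: numeral_2_eq_2)

lemma continuous_grad: "continuous_on \<Omega> (grad w)"
  using C2 Ck_on_Suc_continuous_grad[of 1 \<Omega> w] by (simp add: numeral_2_eq_2)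

lemma continuous_w: "continuous_on \<Omega> w"
  using cont closure_subset by (rule continuous_on_subset)

lemma L2_laplacian: "L2_on \<Omega> (\<lambda>x. - laplacian w x)"
  by (rule L2_on_bounded[OF finite_measure_\<Omega>, of _ B])
    (auto intro!: continuous_imp_measurable_on_sets_lebesgue sets_\<Omega> continuous_intros
      Ck_on_2_continuous_laplacian[OF C2] laplacian_bound)

lemma L2_w: "L2_on \<Omega> w"
  by (rule L2_on_bounded[OF finite_measure_\<Omega>, of _ 1])
    (auto intro!: continuous_imp_measurable_on_sets_lebesgue sets_\<Omega> continuous_w simp: nonneg le_1)

definition w_trunc :: "real \<Rightarrow> 'a \<Rightarrow> real" where
  "w_trunc e x = (if x \<in> \<Omega> then trunc e (w x) else 0)"

definition grad_trunc :: "real \<Rightarrow> 'a \<Rightarrow> 'a" where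
  "grad_trunc e x = (if x \<in> \<Omega> then trunc' e (w x) *\<^sub>R grad w x else 0)"

text \<open>The set where w \<ge> e is closed in the compact closure of \<Omega> and misses the
  boundary, where w = 0 < e. It is therefore a compact subset of \<Omega>, and the truncation
  vanishes off it.\<close>

lemma C1_compact_support_w_trunc:
  assumes "0 < e"
  shows "C1_compact_support \<Omega> (w_trunc e) (grad_trunc e)"
proof -
  define K where "K = {x \<in> closure \<Omega>. e \<le> w x}"
  have "closed K"
    unfolding K_def by (intro continuous_on_closed_Collect_le cont continuous_on_const closed_closure)
  moreover have "bounded K"
    by (rule bounded_subset[OF bounded_closure[OF bounded_\<Omega>]]) (auto simp: K_def)
  ultimately have K: "compact K" by (simp add: compact_eq_bounded_closed)
  have sub: "K \<subseteq> \<Omega>"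
  proof
    fix x assume x: "x \<in> K"
    then have "x \<notin> frontier \<Omega>" using boundary[of x] assms by (auto simp: K_def)
    then show "x \<in> \<Omega>" using x open_\<Omega> by (auto simp: K_def frontier_def interior_open)
  qed
  have small: "w x < e" if "x \<in> \<Omega>" "x \<notin> K" for x
    using that closure_subset by (force simp: K_def)
  have v0: "w_trunc e x = 0" if "x \<notin> K" for x
    using small[OF _ that] assms by (auto simp: w_trunc_def trunc_def max_def)
  have D0: "grad_trunc e x = 0" if "x \<notin> K" for x
    using small[OF _ that] assms by (auto simp: grad_trunc_def trunc'_def max_def)
  have "continuous_on \<Omega> (\<lambda>x. trunc' e (w x) *\<^sub>R grad w x)"
    unfolding trunc'_def using assms
    by (intro continuous_intros continuous_w continuous_grad) auto
  then have "continuous_on \<Omega> (grad_trunc e)"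
    by (rule continuous_on_eq) (simp add: grad_trunc_def)
  then have "continuous_on UNIV (grad_trunc e)"
    by (rule continuous_on_UNIV_extend[OF open_\<Omega> K sub _ D0])
  moreover have "GDERIV (w_trunc e) x :> grad_trunc e x" for x
  proof (rule GDERIV_extend_0[OF open_\<Omega> K sub _ v0 D0])
    fix x assume x: "x \<in> \<Omega>"
    have "GDERIV (\<lambda>x. trunc e (w x)) x :> grad_trunc e x"
      using GDERIV_DERIV_compose[OF GDERIV_w[OF x] DERIV_trunc[OF assms]] x
      by (simp add: grad_trunc_def)
    then show "GDERIV (w_trunc e) x :> grad_trunc e x"
      unfolding gderiv_def
      by (rule has_derivative_transform_within_open[OF _ open_\<Omega> x]) (simp add: w_trunc_def)
  qed
  ultimately show ?thesis
    unfolding C1_compact_support_def using K sub v0 by blast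
qed

text \<open>A zero of the nonnegative function \<open>w\<close> inside \<Omega> is a
  minimum.\<close>

lemma grad_eq_0_if_w_eq_0:
  assumes "x \<in> \<Omega>" "w x = 0" shows "grad w x = 0"
proof -
  have "(\<lambda>h. h \<bullet> grad w x) = (\<lambda>h. 0)"
    by (rule differential_zero_maxmin[OF assms(1) open_\<Omega>])
      (use GDERIV_w[OF assms(1)] nonneg assms(2) in \<open>auto simp: gderiv_def\<close>)
  then show ?thesis by (metis inner_eq_zero_iff)
qed

lemma grad_trunc_tendsto:
  assumes "e \<longlonglongrightarrow> 0" "x \<in> \<Omega>"
  shows "(\<lambda>n. grad_trunc (e n) x) \<longlonglongrightarrow> grad w x"
proof (cases "w x = 0")
  case True
  then show ?thesis using assms(2) by (simp add: grad_trunc_def grad_eq_0_if_w_eq_0)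
next
  case False
  then have "(\<lambda>n. trunc' (e n) (w x) *\<^sub>R grad w x) \<longlonglongrightarrow> 1 *\<^sub>R grad w x"
    using nonneg[OF assms(2)] by (intro tendsto_intros trunc'_tendsto assms(1)) auto
  then show ?thesis using assms(2) by (simp add: grad_trunc_def)
qed

text \<open>Testing \<open>- \<Delta> w\<close> with the truncations bounds their Dirichlet energy uniformly.\<close>
lemma grad_trunc_energy:
  assumes "0 < e"
  shows "integrable (lebesgue_on \<Omega>) (\<lambda>x. grad_trunc e x \<bullet> grad w x)"
    and "(LINT x|lebesgue_on \<Omega>. grad_trunc e x \<bullet> grad w x) \<le> B * measure lebesgue \<Omega>"
proof -
  obtain K where K: "compact K" "K \<subseteq> \<Omega>" "\<And>x. x \<notin> K \<Longrightarrow> grad_trunc e x = 0"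
    "continuous_on UNIV (grad_trunc e)"
    using C1_compact_supportE[OF C1_compact_support_w_trunc[OF assms]] by metis
  have "continuous_on UNIV (\<lambda>x. grad_trunc e x \<bullet> grad w x)"
    by (rule continuous_on_UNIV_extend[OF open_\<Omega> K(1,2)])
      (auto intro!: continuous_intros continuous_grad continuous_on_subset[OF K(4)] simp: K(3))
  then show "integrable (lebesgue_on \<Omega>) (\<lambda>x. grad_trunc e x \<bullet> grad w x)"
    by (intro integrable_lebesgue_on_if_lborel[OF sets_\<Omega>]
        integrable_continuous_compact_support[OF _ K(1)]) (simp_all add: K(3))
  interpret finite_measure "lebesgue_on \<Omega>" by (rule finite_measure_\<Omega>)
  have "(LINT x|lebesgue_on \<Omega>. grad_trunc e x \<bullet> grad w x)
      = (LINT x|lebesgue_on \<Omega>. w_trunc e x * - laplacian w x)"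
    by (simp add: Green_compact_support[OF C1_compact_support_w_trunc[OF assms] open_\<Omega> C2])
  also have "\<dots> \<le> (LINT x|lebesgue_on \<Omega>. B)"
  proof (rule integral_mono')
    fix x assume "x \<in> space (lebesgue_on \<Omega>)"
    then have x: "x \<in> \<Omega>" by simp
    have "0 \<le> w_trunc e x" "w_trunc e x \<le> 1"
      using trunc_bounds[OF assms nonneg[OF x]] le_1[OF x] x by (auto simp: w_trunc_def)
    moreover have "- laplacian w x \<le> B" "0 \<le> B" using laplacian_bound[OF x] by auto
    ultimately show "w_trunc e x * - laplacian w x \<le> B"
      by (smt (verit) mult_left_le_one_le mult_nonneg_nonpos)
    show "0 \<le> B" by fact
  qed simp
  also have "\<dots> = B * measure lebesgue \<Omega>"
    using sets_\<Omega> by (simp add: measure_restrict_space)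
  finally show "(LINT x|lebesgue_on \<Omega>. grad_trunc e x \<bullet> grad w x) \<le> B * measure lebesgue \<Omega>" .
qed

text \<open>Fatou's lemma along the levels 1/(n+1): the energy integrands are nonnegative, converge
  pointwise to the squared norm of the gradient, and have uniformly bounded integrals.\<close>

lemma L2_grad: "L2_on \<Omega> (grad w)"
proof -
  let ?M = "lebesgue_on \<Omega>" and ?e = "\<lambda>n. inverse (real (Suc n))"
  have meas: "grad w \<in> borel_measurable ?M"
    by (rule continuous_imp_measurable_on_sets_lebesgue[OF continuous_grad sets_\<Omega>])
  have "(\<integral>\<^sup>+x. ennreal ((norm (grad w x))\<^sup>2) \<partial>?M)
      = (\<integral>\<^sup>+x. liminf (\<lambda>n. ennreal (grad_trunc (?e n) x \<bullet> grad w x)) \<partial>?M)"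
  proof (rule nn_integral_cong)
    fix x assume "x \<in> space ?M"
    then have "(\<lambda>n. grad_trunc (?e n) x \<bullet> grad w x) \<longlonglongrightarrow> grad w x \<bullet> grad w x"
      by (intro tendsto_intros grad_trunc_tendsto LIMSEQ_inverse_real_of_nat) simp
    then have "(\<lambda>n. ennreal (grad_trunc (?e n) x \<bullet> grad w x)) \<longlonglongrightarrow> ennreal ((norm (grad w x))\<^sup>2)"
      by (simp add: power2_norm_eq_inner)
    then show "ennreal ((norm (grad w x))\<^sup>2)
        = liminf (\<lambda>n. ennreal (grad_trunc (?e n) x \<bullet> grad w x))"
      by (intro lim_imp_Liminf[symmetric]) simp
  qed
  also have "\<dots> \<le> liminf (\<lambda>n. \<integral>\<^sup>+x. ennreal (grad_trunc (?e n) x \<bullet> grad w x) \<partial>?M)"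
    using grad_trunc_energy(1) by (intro nn_integral_liminf) auto
  also have "\<dots> \<le> liminf (\<lambda>n::nat. ennreal (B * measure lebesgue \<Omega>))"
  proof (rule Liminf_mono, rule always_eventually, rule allI)
    fix n
    have "0 \<le> grad_trunc (?e n) x \<bullet> grad w x" for x
      by (simp add: grad_trunc_def trunc'_bounds)
    then show "(\<integral>\<^sup>+x. ennreal (grad_trunc (?e n) x \<bullet> grad w x) \<partial>?M) \<le> ennreal (B * measure lebesgue \<Omega>)"
      using grad_trunc_energy[of "?e n"] by (simp add: nn_integral_eq_integral ennreal_leI)
  qed
  also have "\<dots> < \<infinity>" by (simp add: Liminf_const)
  finally show ?thesis
    using meas by (auto simp: L2_on_def intro!: integrableI_bounded)
qed

text \<open>Both sides equal the integral of \<open>G x \<bullet> grad w x\<close>, where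
  \<open>G\<close> is the weak gradient of \<phi>. One limit runs through test functions tending to
  \<phi>, the other through truncations tending to \<open>w\<close>.\<close>

lemma eigenfunction_identity:
  assumes "dirichlet_eigenfunction \<Omega> l \<phi>"
  shows "(LINT x|lebesgue_on \<Omega>. \<phi> x * - laplacian w x) = l * (LINT x|lebesgue_on \<Omega>. \<phi> x * w x)"
proof -
  let ?M = "lebesgue_on \<Omega>" and ?e = "\<lambda>n. inverse (real (Suc n))"
  obtain G where H: "H01 \<Omega> \<phi> G"
    and eig: "\<And>v D. H01 \<Omega> v D \<Longrightarrow> (LINT x|?M. G x \<bullet> D x) = l * (LINT x|?M. \<phi> x * v x)"
    using assms by (auto simp: dirichlet_eigenfunction_def)
  from H have L2: "L2_on \<Omega> \<phi>" "L2_on \<Omega> G" by (auto simp: H01_def)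
  obtain \<psi> where \<psi>: "\<And>n::nat. test_function \<Omega> (\<psi> n)"
    "(\<lambda>n. LINT x|?M. (\<psi> n x - \<phi> x)\<^sup>2) \<longlonglongrightarrow> 0"
    "(\<lambda>n. LINT x|?M. (norm (grad (\<psi> n) x - G x))\<^sup>2) \<longlonglongrightarrow> 0"
    using H by (auto simp: H01_def)
  have \<psi>H: "H01 \<Omega> (\<psi> n) (grad (\<psi> n))" for n
    by (intro H01_C1_compact_support open_\<Omega> bounded_\<Omega> test_function_C1_compact_support \<psi>(1))
  have \<psi>L2: "L2_on \<Omega> (\<psi> n)" "L2_on \<Omega> (grad (\<psi> n))" for n
    using \<psi>H[of n] by (auto simp: H01_def)
  have lim_\<phi>: "(\<lambda>n. LINT x|?M. \<psi> n x \<bullet> (- laplacian w x)) \<longlonglongrightarrow> (LINT x|?M. \<phi> x \<bullet> (- laplacian w x))"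
    using \<psi>(2) by (intro L2_on_tendsto_inner \<psi>L2 L2 L2_laplacian) simp
  have "(\<lambda>n. LINT x|?M. grad (\<psi> n) x \<bullet> grad w x) \<longlonglongrightarrow> (LINT x|?M. G x \<bullet> grad w x)"
    using \<psi>(3) by (intro L2_on_tendsto_inner \<psi>L2 L2 L2_grad)
  moreover have "(LINT x|?M. grad (\<psi> n) x \<bullet> grad w x) = (LINT x|?M. \<psi> n x \<bullet> (- laplacian w x))" for n
    by (simp add: Green_compact_support[OF test_function_C1_compact_support[OF \<psi>(1)] open_\<Omega> C2])
  ultimately have "(\<lambda>n. LINT x|?M. \<psi> n x \<bullet> (- laplacian w x)) \<longlonglongrightarrow> (LINT x|?M. G x \<bullet> grad w x)"
    by simp
  from LIMSEQ_unique[OF lim_\<phi> this]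
  have 1: "(LINT x|?M. \<phi> x * - laplacian w x) = (LINT x|?M. G x \<bullet> grad w x)"
    by simp
  have trunc_eq: "(LINT x|?M. G x \<bullet> grad_trunc (?e n) x) = l * (LINT x|?M. \<phi> x * w_trunc (?e n) x)" for n
    by (rule eig[OF H01_C1_compact_support[OF open_\<Omega> bounded_\<Omega> C1_compact_support_w_trunc]]) simp
  have trunc_L2: "L2_on \<Omega> (w_trunc (?e n))" "L2_on \<Omega> (grad_trunc (?e n))" for n
    using H01_C1_compact_support[OF open_\<Omega> bounded_\<Omega> C1_compact_support_w_trunc[of "?e n"]]
    by (auto simp: H01_def)
  \<comment> \<open>The factor \<open>trunc'\<close> lies in [0,1], so the limit integrand
    dominates; it is integrable because \<open>grad w\<close> is square integrable.\<close>
  have lim_G: "(\<lambda>n. LINT x|?M. G x \<bullet> grad_trunc (?e n) x) \<longlonglongrightarrow> (LINT x|?M. G x \<bullet> grad w x)"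
  proof (rule integral_dominated_convergence[where w = "\<lambda>x. \<bar>G x \<bullet> grad w x\<bar>"])
    show "(\<lambda>x. G x \<bullet> grad w x) \<in> borel_measurable ?M" "integrable ?M (\<lambda>x. \<bar>G x \<bullet> grad w x\<bar>)"
      using L2_on_inner_integrable[OF L2(2) L2_grad] by auto
    show "(\<lambda>x. G x \<bullet> grad_trunc (?e n) x) \<in> borel_measurable ?M" for n
      using L2_on_inner_integrable[OF L2(2) trunc_L2(2)] by auto
    show "AE x in ?M. (\<lambda>n. G x \<bullet> grad_trunc (?e n) x) \<longlonglongrightarrow> G x \<bullet> grad w x"
      by (intro AE_I2 tendsto_intros grad_trunc_tendsto LIMSEQ_inverse_real_of_nat) simp
    show "AE x in ?M. norm (G x \<bullet> grad_trunc (?e n) x) \<le> \<bar>G x \<bullet> grad w x\<bar>" for n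
    proof (rule AE_I2)
      fix x assume "x \<in> space ?M"
      then have "G x \<bullet> grad_trunc (?e n) x = trunc' (?e n) (w x) * (G x \<bullet> grad w x)"
        by (simp add: grad_trunc_def)
      then show "norm (G x \<bullet> grad_trunc (?e n) x) \<le> \<bar>G x \<bullet> grad w x\<bar>"
        using trunc'_bounds[of "?e n" "w x"] by (simp add: abs_mult mult_left_le_one_le)
    qed
  qed
  have lim_w: "(\<lambda>n. LINT x|?M. \<phi> x * w_trunc (?e n) x) \<longlonglongrightarrow> (LINT x|?M. \<phi> x * w x)"
  proof (rule integral_dominated_convergence[where w = "\<lambda>x. \<bar>\<phi> x * w x\<bar>"])
    show "(\<lambda>x. \<phi> x * w x) \<in> borel_measurable ?M" "integrable ?M (\<lambda>x. \<bar>\<phi> x * w x\<bar>)"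
      using L2_on_inner_integrable[OF L2(1) L2_w] by auto
    show "(\<lambda>x. \<phi> x * w_trunc (?e n) x) \<in> borel_measurable ?M" for n
      using L2_on_inner_integrable[OF L2(1) trunc_L2(1)[of n]] by simp
    show "AE x in ?M. (\<lambda>n. \<phi> x * w_trunc (?e n) x) \<longlonglongrightarrow> \<phi> x * w x"
    proof (rule AE_I2)
      fix x assume "x \<in> space ?M"
      then show "(\<lambda>n. \<phi> x * w_trunc (?e n) x) \<longlonglongrightarrow> \<phi> x * w x"
        using trunc_tendsto[OF LIMSEQ_inverse_real_of_nat nonneg[of x]]
        by (intro tendsto_intros) (simp add: w_trunc_def)
    qed
    show "AE x in ?M. norm (\<phi> x * w_trunc (?e n) x) \<le> \<bar>\<phi> x * w x\<bar>" for n
    proof (rule AE_I2)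
      fix x assume x: "x \<in> space ?M"
      then show "norm (\<phi> x * w_trunc (?e n) x) \<le> \<bar>\<phi> x * w x\<bar>"
        using trunc_bounds[of "?e n" "w x"] nonneg[of x]
        by (simp add: w_trunc_def abs_mult mult_left_mono)
    qed
  qed
  have "(LINT x|?M. G x \<bullet> grad w x) = l * (LINT x|?M. \<phi> x * w x)"
    by (rule LIMSEQ_unique[OF lim_G[unfolded trunc_eq] tendsto_mult_left[OF lim_w]])
  with 1 show ?thesis by (rule trans)
qed

lemma weighted_mean_bound:
  assumes \<phi>: "dirichlet_eigenfunction \<Omega> l \<phi>" "\<And>x. x \<in> \<Omega> \<Longrightarrow> 0 < \<phi> x"
    "(LINT x|lebesgue_on \<Omega>. \<phi> x) = 1"
    and "0 < l" "0 < c"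
    and a: "\<And>x. x \<in> \<Omega> \<Longrightarrow> 0 \<le> a x" "\<And>x. x \<in> \<Omega> \<Longrightarrow> c * a x \<le> - laplacian w x"
  shows "ennreal (LINT x|lebesgue_on \<Omega>. w x * \<phi> x)
    \<le> ennreal l * quotient_integral \<Omega> \<phi> a / ennreal c"
proof -
  let ?M = "lebesgue_on \<Omega>"
  define W where "W = (LINT x|?M. \<phi> x * w x)"
  \<comment> \<open>With this value s^2 * l / c = s, so the integral of \<open>q\<close> becomes
    exactly s * (2 - W).\<close>
  define s where "s = c / l"
  \<comment> \<open>From (1 - s a)^2 \<ge> 0 one gets \<phi>/a \<ge> 2 s \<phi> - s^2 a \<phi>;
    replacing a by its upper bound, minus the Laplacian over c, yields \<open>q\<close>.\<close>
  define q where "q x = 2 * s * \<phi> x - s\<^sup>2 / c * (\<phi> x * - laplacian w x)" for x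
  have s: "0 < s" using assms by (simp add: s_def)
  have L2: "L2_on \<Omega> \<phi>" using \<phi>(1) by (auto simp: dirichlet_eigenfunction_def H01_def)
  \<comment> \<open>A function that is not integrable has Bochner integral 0, not 1.\<close>
  have int: "integrable ?M \<phi>"
    using \<phi>(3) not_integrable_integral_eq by fastforce
  have int_w: "integrable ?M (\<lambda>x. \<phi> x * w x)" and int_h: "integrable ?M (\<lambda>x. \<phi> x * - laplacian w x)"
    using L2_on_inner_integrable[OF L2 L2_w] L2_on_inner_integrable[OF L2 L2_laplacian] by simp_all
  have int_q: "integrable ?M q"
    unfolding q_def using int int_h by (intro Bochner_Integration.integrable_diff integrable_mult_right)
  \<comment> \<open>Since the integral of \<phi> is 1, this gives W \<le> 1, which allows 2 - W to
    be bounded below by W.\<close>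
  have "W \<le> (LINT x|?M. \<phi> x)"
    unfolding W_def using \<phi>(2) le_1 by (intro integral_mono int_w int) (auto simp: mult_le_cancel_left1 less_imp_le)
  then have "W \<le> 1" by (simp add: \<phi>(3))
  have "0 \<le> W"
    unfolding W_def using \<phi>(2) nonneg by (intro integral_nonneg_AE AE_I2) (auto simp: less_imp_le)
  have "(LINT x|?M. q x) = 2 * s - s\<^sup>2 / c * (l * W)"
    unfolding q_def W_def eigenfunction_identity[OF \<phi>(1), symmetric]
    using int int_h by (simp only: Bochner_Integration.integral_diff integrable_mult_right
        integral_mult_right_zero \<phi>(3) mult_1_right)
  also have "\<dots> = s * (2 - W)"
    using assms by (simp add: s_def field_simps power2_eq_square)
  finally have "s * W \<le> (LINT x|?M. q x)"
    using s \<open>W \<le> 1\<close> by simp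
  \<comment> \<open>The function \<open>q\<close> may be negative; its positive part permits the
    passage to the nonnegative integral.\<close>
  also have "\<dots> \<le> (LINT x|?M. max 0 (q x))"
    using int_q by (intro integral_mono) auto
  finally have "ennreal (s * W) \<le> (\<integral>\<^sup>+x. ennreal (max 0 (q x)) \<partial>?M)"
    using int_q by (subst nn_integral_eq_integral) (auto intro!: ennreal_leI)
  also have "\<dots> \<le> quotient_integral \<Omega> \<phi> a"
    unfolding quotient_integral_def
  proof (rule nn_integral_mono)
    fix x assume "x \<in> space ?M"
    then have x: "x \<in> \<Omega>" by simp
    show "ennreal (max 0 (q x)) \<le> ennreal (\<phi> x) / ennreal (a x)"
    \<comment> \<open>Where the weight vanishes, positivity of \<phi> makes the extended quotient
      infinite.\<close>
    proof (cases "a x = 0")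
      case True
      then show ?thesis using \<phi>(2)[OF x] by (simp add: ennreal_divide_zero)
    next
      case False
      then have ax: "0 < a x" using a(1)[OF x] by simp
      have "q x \<le> 2 * s * \<phi> x - s\<^sup>2 / c * (\<phi> x * (c * a x))"
        unfolding q_def using a(2)[OF x] \<phi>(2)[OF x] \<open>0 < c\<close>
        by (intro diff_left_mono mult_left_mono) auto
      \<comment> \<open>Completing the square.\<close>
      also have "\<dots> = \<phi> x / a x - \<phi> x / a x * (1 - s * a x)\<^sup>2"
        using ax \<open>0 < c\<close> by (simp add: field_simps power2_eq_square)
      also have "\<dots> \<le> \<phi> x / a x" using ax \<phi>(2)[OF x] by simp
      finally show ?thesis
        using ax \<phi>(2)[OF x] by (simp add: divide_ennreal less_imp_le)
    qed
  qed
  finally have "ennreal l * ennreal (s * W) / ennreal c \<le> ennreal l * quotient_integral \<Omega> \<phi> a / ennreal c"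
    by (intro divide_right_mono_ennreal mult_left_mono) auto
  also have "ennreal l * ennreal (s * W) / ennreal c = ennreal W"
    using assms \<open>0 \<le> W\<close> by (simp add: s_def divide_ennreal ennreal_mult[symmetric])
  finally show ?thesis by (simp add: W_def mult.commute)
qed

end

section \<open>Application to the system (E)\<close>

lemma hoelder_on_bounded:
  assumes "bounded S" "hoelder_on S u"
  obtains B where "\<And>x. x \<in> S \<Longrightarrow> \<bar>u x\<bar> \<le> B"
proof (cases "S = {}")
  case False
  then obtain y where y: "y \<in> S" by auto
  obtain \<gamma> C where \<gamma>: "0 < \<gamma>" "\<And>x. x \<in> S \<Longrightarrow> \<bar>u x - u y\<bar> \<le> C * dist x y powr \<gamma>"
    using assms(2) y by (auto simp: hoelder_on_def)
  obtain D where D: "\<And>x. x \<in> S \<Longrightarrow> dist y x \<le> D"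
    using assms(1) bounded_any_center[of S y] by auto
  \<comment> \<open>The sign of the Hoelder constant is unspecified, hence its absolute
    value.\<close>
  have "\<bar>u x\<bar> \<le> \<bar>u y\<bar> + \<bar>C\<bar> * D powr \<gamma>" if "x \<in> S" for x
  proof -
    have "C * dist x y powr \<gamma> \<le> \<bar>C\<bar> * D powr \<gamma>"
      using D[OF that] \<gamma>(1) by (intro mult_mono powr_mono2) (auto simp: dist_commute)
    then show ?thesis using \<gamma>(2)[OF that] by linarith
  qed
  then show thesis by (rule that)
qed (use that in auto)

text \<open>On the compact closure \<open>z\<close> attains a maximum below 1, which keeps
  \<open>f (z x)\<close> away from the singularity; monotonicity also gives the lower bound by
  \<open>f 0\<close>.\<close>

lemma reaction_term_bounds:
  fixes z :: "'a::euclidean_space \<Rightarrow> real"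
  assumes "bounded \<Omega>" "weight \<Omega> a" "singular_nonlinearity f"
    and z: "continuous_on (closure \<Omega>) z" "\<And>x. x \<in> closure \<Omega> \<Longrightarrow> 0 \<le> z x \<and> z x < 1"
  shows "\<exists>B. \<forall>x\<in>closure \<Omega>. \<bar>a x * f (z x)\<bar> \<le> B"
    and "\<And>x. x \<in> closure \<Omega> \<Longrightarrow> f 0 * a x \<le> a x * f (z x)"
proof -
  have f: "mono_on {0..<1} f" "\<And>t. 0 \<le> t \<Longrightarrow> t < 1 \<Longrightarrow> 0 < f t"
    using assms(3) by (auto simp: singular_nonlinearity_def)
  have a: "\<And>x. x \<in> closure \<Omega> \<Longrightarrow> 0 \<le> a x" "closure \<Omega> \<noteq> {}"
    using assms(2) by (auto simp: weight_def)
  obtain A where A: "\<And>x. x \<in> closure \<Omega> \<Longrightarrow> \<bar>a x\<bar> \<le> A"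
    using hoelder_on_bounded[OF bounded_closure[OF assms(1)], of a] assms(2)
    unfolding weight_def by metis
  obtain y where y: "y \<in> closure \<Omega>" "\<And>x. x \<in> closure \<Omega> \<Longrightarrow> z x \<le> z y"
    using continuous_attains_sup[OF _ a(2) z(1)] assms(1) by (auto simp: compact_closure)
  have fz: "f 0 \<le> f (z x)" "f (z x) \<le> f (z y)" "0 < f (z x)" if "x \<in> closure \<Omega>" for x
    using z(2)[OF that] z(2)[OF y(1)] y(2)[OF that] f
    by (auto intro!: monotone_onD[OF f(1)])
  have "\<bar>a x * f (z x)\<bar> \<le> A * f (z y)" if "x \<in> closure \<Omega>" for x
    unfolding abs_mult using A[OF that] fz[OF that] by (intro mult_mono) auto
  then show "\<exists>B. \<forall>x\<in>closure \<Omega>. \<bar>a x * f (z x)\<bar> \<le> B" by blast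
  show "f 0 * a x \<le> a x * f (z x)" if "x \<in> closure \<Omega>" for x
    using fz(1)[OF that] a(1)[OF that] by (simp add: mult.commute mult_left_mono)
qed

text \<open>Treats one equation with the other component as a given function. The weight inequality
  for the Laplacian holds with constant \<open>k * f 0\<close>.\<close>

lemma reaction_equation_mean_bound:
  fixes w z :: "'a::euclidean_space \<Rightarrow> real"
  assumes \<Omega>: "open \<Omega>" "bounded \<Omega>" and a: "weight \<Omega> a" and f: "singular_nonlinearity f"
    and w: "Ck_on 2 \<Omega> w" "continuous_on (closure \<Omega>) w" "\<And>x. x \<in> closure \<Omega> \<Longrightarrow> 0 \<le> w x \<and> w x < 1"
      "\<And>x. x \<in> frontier \<Omega> \<Longrightarrow> w x = 0" "\<And>x. x \<in> \<Omega> \<Longrightarrow> - laplacian w x = k * a x * f (z x)"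
    and z: "continuous_on (closure \<Omega>) z" "\<And>x. x \<in> closure \<Omega> \<Longrightarrow> 0 \<le> z x \<and> z x < 1"
    and \<phi>: "dirichlet_eigenfunction \<Omega> l \<phi>" "\<And>x. x \<in> \<Omega> \<Longrightarrow> 0 < \<phi> x"
      "(LINT x|lebesgue_on \<Omega>. \<phi> x) = 1"
    and "0 < l" "0 < k"
  shows "ennreal (LINT x|lebesgue_on \<Omega>. w x * \<phi> x)
    \<le> ennreal l * quotient_integral \<Omega> \<phi> a / ennreal (k * f 0)"
proof -
  have sub: "x \<in> closure \<Omega>" if "x \<in> \<Omega>" for x using closure_subset that by (rule subsetD)
  obtain B where B: "\<forall>x\<in>closure \<Omega>. \<bar>a x * f (z x)\<bar> \<le> B"
    using reaction_term_bounds(1)[OF \<Omega>(2) a f z] by blast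
  have reaction: "f 0 * a x \<le> a x * f (z x)" if "x \<in> closure \<Omega>" for x
    by (rule reaction_term_bounds(2)[OF \<Omega>(2) a f z(1) _ that]) (rule z(2))
  interpret dirichlet_C2 \<Omega> w "k * B"
  proof
    fix x assume x: "x \<in> \<Omega>"
    show "0 \<le> w x" "w x \<le> 1" using w(3)[OF sub[OF x]] by auto
    have "laplacian w x = - (k * (a x * f (z x)))" using w(5)[OF x] by (simp only: mult.assoc)
    then show "\<bar>laplacian w x\<bar> \<le> k * B"
      using mult_left_mono[OF bspec[OF B sub[OF x]], of k] \<open>0 < k\<close> by (simp only: abs_minus_cancel abs_mult abs_of_pos)
  qed (rule \<Omega> w; assumption)+
  show ?thesis
  proof (rule weighted_mean_bound[OF \<phi> \<open>0 < l\<close>])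
    show "0 < k * f 0" using f \<open>0 < k\<close> by (simp add: singular_nonlinearity_def)
    fix x assume x: "x \<in> \<Omega>"
    show "0 \<le> a x" using a sub[OF x] by (simp add: weight_def)
    show "k * f 0 * a x \<le> - laplacian w x"
      using mult_left_mono[OF reaction[OF sub[OF x]], of k] w(5)[OF x] \<open>0 < k\<close> by (simp add: mult.assoc)
  qed
qed

text \<open>Exchanging the roles of the components together with their weights, nonlinearities and
  parameters turns one equation into the other, so the single-equation bound is applied
  twice.\<close>

lemma solution_mean_bound:
  assumes "smooth_bounded_domain \<Omega>" "weight \<Omega> \<alpha>" "weight \<Omega> \<beta>"
    and "singular_nonlinearity f" "singular_nonlinearity g" "0 < l" "0 < m"
    and sol: "solution \<Omega> \<alpha> \<beta> f g l m w z"
    and "0 < l1" "dirichlet_eigenfunction \<Omega> l1 \<phi>" "\<forall>x\<in>\<Omega>. 0 < \<phi> x"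
      "(LINT x|lebesgue_on \<Omega>. \<phi> x) = 1"
  shows "ennreal (LINT x|lebesgue_on \<Omega>. w x * \<phi> x)
      \<le> ennreal l1 * quotient_integral \<Omega> \<phi> \<alpha> / ennreal (l * f 0)"
    and "ennreal (LINT x|lebesgue_on \<Omega>. z x * \<phi> x)
      \<le> ennreal l1 * quotient_integral \<Omega> \<phi> \<beta> / ennreal (m * g 0)"
proof -
  have \<Omega>: "open \<Omega>" "bounded \<Omega>" using assms(1) by (auto simp: smooth_bounded_domain_def)
  from sol have s: "Ck_on 2 \<Omega> w" "Ck_on 2 \<Omega> z"
    "continuous_on (closure \<Omega>) w" "continuous_on (closure \<Omega>) z"
    "\<And>x. x \<in> closure \<Omega> \<Longrightarrow> 0 \<le> w x \<and> w x < 1" "\<And>x. x \<in> closure \<Omega> \<Longrightarrow> 0 \<le> z x \<and> z x < 1"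
    "\<And>x. x \<in> \<Omega> \<Longrightarrow> - laplacian w x = l * \<alpha> x * f (z x)"
    "\<And>x. x \<in> \<Omega> \<Longrightarrow> - laplacian z x = m * \<beta> x * g (w x)"
    "\<And>x. x \<in> frontier \<Omega> \<Longrightarrow> w x = 0" "\<And>x. x \<in> frontier \<Omega> \<Longrightarrow> z x = 0"
    unfolding solution_def by auto
  have pos: "\<And>x. x \<in> \<Omega> \<Longrightarrow> 0 < \<phi> x" using assms(11) by blast
  show "ennreal (LINT x|lebesgue_on \<Omega>. w x * \<phi> x)
      \<le> ennreal l1 * quotient_integral \<Omega> \<phi> \<alpha> / ennreal (l * f 0)"
    by (rule reaction_equation_mean_bound[OF \<Omega> assms(2,4) s(1,3,5,9,7,4,6) assms(10) pos assms(12,9,6)])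
  show "ennreal (LINT x|lebesgue_on \<Omega>. z x * \<phi> x)
      \<le> ennreal l1 * quotient_integral \<Omega> \<phi> \<beta> / ennreal (m * g 0)"
    by (rule reaction_equation_mean_bound[OF \<Omega> assms(3,5) s(2,4,6,10,8,3,5) assms(10) pos assms(12,9,7)])
qed

theorem corollary1p1:
  fixes \<Omega> :: "'a::euclidean_space set"
    and \<alpha> \<beta> w z \<phi> :: "'a \<Rightarrow> real"
    and f g \<Gamma> :: "real \<Rightarrow> real"
    and l m ls ms l1 :: real
  assumes "smooth_bounded_domain \<Omega>"
    and "weight \<Omega> \<alpha>" and "weight \<Omega> \<beta>"
    and "singular_nonlinearity f" and "singular_nonlinearity g"
    and "critical_curve \<Omega> \<alpha> \<beta> f g ls ms \<Gamma>"
    and "(l, m) \<in> O1_set \<Omega> \<alpha> \<beta> f g ls \<Gamma>"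
    and "minimal_solution \<Omega> \<alpha> \<beta> f g l m w z"
    and "first_dirichlet_eigenvalue \<Omega> l1" and "0 < l1"
    and "dirichlet_eigenfunction \<Omega> l1 \<phi>"
    and "\<forall>x\<in>\<Omega>. 0 < \<phi> x"
    and "(LINT x|lebesgue_on \<Omega>. \<phi> x) = 1"
  shows "(ennreal (LINT x|lebesgue_on \<Omega>. w x * \<phi> x)
            \<le> ennreal l1 * quotient_integral \<Omega> \<phi> \<alpha> / ennreal (l * f 0) \<and>
          ennreal (LINT x|lebesgue_on \<Omega>. z x * \<phi> x)
            \<le> ennreal l1 * quotient_integral \<Omega> \<phi> \<beta> / ennreal (m * g 0)) \<and>
         (\<forall>w1 z1. solution \<Omega> \<alpha> \<beta> f g l m w1 z1 \<and>
            (\<exists>x\<in>closure \<Omega>. (w1 x, z1 x) \<noteq> (w x, z x)) \<longrightarrow>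
            ennreal (LINT x|lebesgue_on \<Omega>. w1 x * \<phi> x)
              \<le> ennreal l1 * quotient_integral \<Omega> \<phi> \<alpha> / ennreal (l * f 0) \<and>
            ennreal (LINT x|lebesgue_on \<Omega>. z1 x * \<phi> x)
              \<le> ennreal l1 * quotient_integral \<Omega> \<phi> \<beta> / ennreal (m * g 0))"
proof -
  have "0 < l" "0 < m"
    using assms(7) by (auto simp: O1_set_def Lambda_set_def)
  note bound = solution_mean_bound[OF assms(1-5) this _ assms(10-13)]
  \<comment> \<open>The bound holds for every solution, and a minimal solution is one, so both parts
    follow at once.\<close>
  have "solution \<Omega> \<alpha> \<beta> f g l m w z"
    using assms(8) by (simp add: minimal_solution_def)
  then show ?thesis
    using bound by blast
qed

end
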